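(* Let $p$ be a prime and $n\geq1$ an integer having a balanced base $p$ expansion $n=\sum_{k\geq0}b_kp^k$. If $\zeta_p$ is a primitive $p$th root of unity, then for all $d\geq 1$ \[ M_{d,n}(\zeta_p)=\begin{cases}b_k & \text{if } d=p^k,\\ 0&\text{otherwise.}\end{cases} \] Consequently, if $n$ has a balanced base $p$ expansion, then $\Phi_p(x)$ divides $M_{d,n}(x)$ for all but finitely many $d\geq1$.
   Context: A monic polynomial in $K[x_1,\dots,x_n]$ ($K$ a field) means a $K^\times$-orbit of nonzero polynomials under scaling. For $d,n\geq1$, $M_{d,n}(x)\in\mathbb{Q}[x]$ is the polynomial such that for every prime power $q$, $M_{d,n}(q)$ is the number of monic, $\mathbb{F}_q$-irreducible polynomials of total degree $d$ in $\mathbb{F}_q[x_1,\dots,x_n]$. For $b\geq2$, $n$ has a balanced base $b$ expansion if every base-$b$ digit $n_k$ of $n$ is $0$ or $b-1$; in that case, writing each $(b-1)b^k=b^{k+1}-b^k$ and collecting terms gives $n=\sum_k b_kb^k$ with $b_k=[n_{k-1}=b-1]-[n_k=b-1]\in\{-1,0,1\}$ (Iverson brackets, $n_{-1}:=0$). $\Phi_p(x)$ is the $p$th cyclotomic polynomial. *)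

theory Defs
  imports
    Complex_Main
    "HOL-Algebra.Ring_Divisibility"
    "HOL-Library.Multiset"
    "HOL-Number_Theory.Prime_Powers"
    "HOL-Computational_Algebra.Polynomial"
begin

text \<open>
  The ring \<open>R[x\<^sub>0, \<dots>, x\<^sub>n\<^sub>-\<^sub>1]\<close>.  As in \<open>HOL-Algebra.Indexed_Polynomials\<close>, a monomial is the
  multiset of (the indices of) its variables, and a polynomial maps monomials to coefficients;
  the total degree of a monomial is then its size.
\<close>

definition mpoly_ring :: "nat \<Rightarrow> ('a, 'b) ring_scheme \<Rightarrow> (nat multiset \<Rightarrow> 'a) ring" where
  "mpoly_ring n R =
    \<lparr> carrier = {f. (\<forall>m. f m \<in> carrier R) \<and> finite {m. f m \<noteq> \<zero>\<^bsub>R\<^esub>} \<and>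
                    (\<forall>m. f m \<noteq> \<zero>\<^bsub>R\<^esub> \<longrightarrow> set_mset m \<subseteq> {..<n})},
      mult = (\<lambda>f g m. \<Oplus>\<^bsub>R\<^esub>a \<in> {a. a \<subseteq># m}. f a \<otimes>\<^bsub>R\<^esub> g (m - a)),
      one = (\<lambda>m. if m = {#} then \<one>\<^bsub>R\<^esub> else \<zero>\<^bsub>R\<^esub>),
      zero = (\<lambda>m. \<zero>\<^bsub>R\<^esub>),
      add = (\<lambda>f g m. f m \<oplus>\<^bsub>R\<^esub> g m) \<rparr>"

text \<open>Only meaningful for \<open>f\<close> nonzero.\<close>

definition total_degree :: "('a, 'b) ring_scheme \<Rightarrow> (nat multiset \<Rightarrow> 'a) \<Rightarrow> nat" where
  "total_degree R f = Max (size ` {m. f m \<noteq> \<zero>\<^bsub>R\<^esub>})"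

definition scaling_orbit ::
    "('a, 'b) ring_scheme \<Rightarrow> (nat multiset \<Rightarrow> 'a) \<Rightarrow> (nat multiset \<Rightarrow> 'a) set" where
  "scaling_orbit R f = {(\<lambda>m. c \<otimes>\<^bsub>R\<^esub> f m) | c. c \<in> carrier R - {\<zero>\<^bsub>R\<^esub>}}"

definition monic_irreducibles ::
    "nat \<Rightarrow> nat \<Rightarrow> ('a, 'b) ring_scheme \<Rightarrow> (nat multiset \<Rightarrow> 'a) set set" where
  "monic_irreducibles d n R =
    scaling_orbit R ` {f \<in> carrier (mpoly_ring n R).
      ring_irreducible\<^bsub>mpoly_ring n R\<^esub> f \<and> total_degree R f = d}"

text \<open>
  The polynomial \<open>M\<^sub>d\<^sub>,\<^sub>n\<close>.  Every finite field is isomorphic to one whose carrier is a set of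
  natural numbers, so quantifying over such fields covers all of them.
\<close>

definition M_poly :: "nat \<Rightarrow> nat \<Rightarrow> rat poly" where
  "M_poly d n =
    (THE M. \<forall>q::nat. primepow q \<longrightarrow>
       (\<forall>F :: nat ring. field F \<and> card (carrier F) = q \<longrightarrow>
          poly M (of_nat q) = of_nat (card (monic_irreducibles d n F))))"

definition digit :: "nat \<Rightarrow> nat \<Rightarrow> nat \<Rightarrow> nat" where
  "digit b n k = n div b ^ k mod b"

definition balanced :: "nat \<Rightarrow> nat \<Rightarrow> bool" where
  "balanced b n \<longleftrightarrow> (\<forall>k. digit b n k = 0 \<or> digit b n k = b - 1)"

definition balanced_coeff :: "nat \<Rightarrow> nat \<Rightarrow> nat \<Rightarrow> int" where
  "balanced_coeff b n k =
    of_bool (k > 0 \<and> digit b n (k - 1) = b - 1) - of_bool (digit b n k = b - 1)"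

lemma balanced_expansion:
  assumes "b \<ge> 2" "balanced b n"
  shows "{k. balanced_coeff b n k \<noteq> 0} \<subseteq> {..n}"
    and "int n = (\<Sum>k\<le>n. balanced_coeff b n k * int b ^ k)"
proof -
  have small: "n < b ^ k" if "k \<ge> n" for k
  proof -
    have "n < 2 ^ n" by (rule less_exp)
    also have "\<dots> \<le> b ^ n" using assms(1) by (rule power_mono) simp
    also have "\<dots> \<le> b ^ k" using assms(1) that by (intro power_increasing) auto
    finally show ?thesis .
  qed
  have digit0: "digit b n k = 0" if "k \<ge> n" for k
    using small[OF that] by (simp add: digit_def)
  show "{k. balanced_coeff b n k \<noteq> 0} \<subseteq> {..n}"
  proof
    fix k assume "k \<in> {k. balanced_coeff b n k \<noteq> 0}"
    moreover have "balanced_coeff b n k = 0" if "k > n"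
      using that assms(1) digit0[of k] digit0[of "k - 1"] by (simp add: balanced_coeff_def)
    ultimately show "k \<in> {..n}" by (force simp: not_le)
  qed
  have partial: "(\<Sum>k\<le>N. balanced_coeff b n k * int b ^ k) =
      int (n mod b ^ N) - of_bool (digit b n N = b - 1) * int b ^ N" for N
  proof (induction N)
    case 0
    then show ?case by (simp add: balanced_coeff_def)
  next
    case (Suc N)
    have step: "n mod b ^ Suc N = b ^ N * digit b n N + n mod b ^ N"
      unfolding digit_def power_Suc2 by (rule mod_mult2_eq)
    have dig: "int (digit b n N) = of_bool (digit b n N = b - 1) * (int b - 1)"
      using assms by (auto simp: balanced_def dest: spec[of _ N])
    have "int (n mod b ^ Suc N) =
        int b ^ N * (of_bool (digit b n N = b - 1) * (int b - 1)) + int (n mod b ^ N)"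
      by (simp only: step of_nat_add of_nat_mult of_nat_power dig)
    moreover have coeff: "balanced_coeff b n (Suc N) =
        of_bool (digit b n N = b - 1) - of_bool (digit b n (Suc N) = b - 1)"
      by (simp add: balanced_coeff_def)
    ultimately show ?case
      unfolding sum.atMost_Suc Suc coeff by (auto simp: algebra_simps of_bool_def split: if_splits)
  qed
  show "int n = (\<Sum>k\<le>n. balanced_coeff b n k * int b ^ k)"
    using assms(1) small[of n] digit0[of n] by (simp add: partial)
qed

definition primitive_root_of_unity :: "nat \<Rightarrow> complex \<Rightarrow> bool" where
  "primitive_root_of_unity n z \<longleftrightarrow> n > 0 \<and> z ^ n = 1 \<and> (\<forall>k. 0 < k \<and> k < n \<longrightarrow> z ^ k \<noteq> 1)"

text \<open>The rational polynomial whose image in \<open>\<complex>[x]\<close> is the product of \<open>x - \<zeta>\<close> over all primitive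
  \<open>n\<close>-th roots of unity \<open>\<zeta>\<close>.\<close>

definition cyclotomic :: "nat \<Rightarrow> rat poly" where
  "cyclotomic n =
    (THE P. map_poly of_rat P = (\<Prod>z | primitive_root_of_unity n z. [:- z, 1:]))"

end

theory Submission
  imports
    Defs
    "HOL-Algebra.UnivPoly"
    "HOL-Algebra.Weak_Morphisms"
    "HOL-Number_Theory.Residues"
    "HOL-Computational_Algebra.Formal_Power_Series"
begin

text \<open>
  Polynomials in \<open>n\<close> variables over a finite field with \<open>q\<close> elements factor uniquely. Counting the
  prime powers that divide the monic polynomials of degree \<open>d\<close>, weighted by the degree of the prime,
  yields the recursion \<open>d Q\<^sub>d = (\<Sum>k=1..d. (\<Sum>j | j dvd k. j M\<^sub>j) Q\<^sub>d\<^sub>-\<^sub>k)\<close>,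
  where \<open>Q\<^sub>d\<close> and \<open>M\<^sub>d\<close> are the numbers of all, respectively of the irreducible, monic polynomials
  of degree \<open>d\<close>. It determines the \<open>M\<^sub>d\<close>, and since
  \<open>(q - 1) Q\<^sub>d = q ^ (n + d choose n) - q ^ (n + d - 1 choose n)\<close> is polynomial in \<open>q\<close>, it may be
  evaluated at \<open>\<zeta>\<^sub>p\<close>. There only the binomial coefficients modulo \<open>p\<close> matter: for balanced \<open>n\<close>, Lucas'
  theorem shows that they are \<open>0\<close> or \<open>1\<close>, and the series \<open>\<Sum>\<^sub>d Q\<^sub>d(\<zeta>\<^sub>p) X\<^sup>d\<close> becomes the product of the
  \<open>(1 - X ^ p ^ k) ^ (- b\<^sub>k)\<close>. Its logarithmic derivative is the same recursion, solved by
  \<open>M\<^sub>d = b\<^sub>k\<close> for \<open>d = p ^ k\<close> and \<open>M\<^sub>d = 0\<close> otherwise.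
\<close>


section \<open>Multivariate polynomials over a domain\<close>

text \<open>Unique factorization has to be established for the concrete ring
  \<open>mpoly_ring\<close>. One variable is adjoined at a time, with a form of Gauss's lemma that
  relies on pseudo-division and needs neither gcds nor a fraction field. The recursion takes the
  place of an infinite Euler product: it is linear, and the unknown of index \<open>d\<close> enters
  its \<open>d\<close>-th instance only with the factor \<open>d Q_0 = d\<close>, so over a field of
  characteristic 0 it has one solution. This uniqueness is used twice, at \<open>x = q\<close> to
  recognise the counts and at \<open>x = \<zeta>\<close> to recognise the \<open>b_k\<close>; the
  coefficients of \<open>M_d\<close> are never computed. Balancedness matters because a residue
  \<open>e\<close> that is 0 or 1 satisfies \<open>\<zeta> ^ e = 1 + (\<zeta> - 1) * e\<close>:
  powers become linear in the residues, the denominator \<open>\<zeta> - 1\<close> of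
  \<open>Q_d\<close> cancels, and a generating function of residues remains. The final divisibility
  then follows from vanishing at all \<open>p - 1\<close> primitive roots, by comparing
  degrees.\<close>

lemma mpoly_ring_sel:
  "f \<in> carrier (mpoly_ring n R) \<longleftrightarrow> (\<forall>m. f m \<in> carrier R) \<and> finite {m. f m \<noteq> \<zero>\<^bsub>R\<^esub>} \<and>
     (\<forall>m. f m \<noteq> \<zero>\<^bsub>R\<^esub> \<longrightarrow> set_mset m \<subseteq> {..<n})"
  "(f \<otimes>\<^bsub>mpoly_ring n R\<^esub> g) m = (\<Oplus>\<^bsub>R\<^esub>a \<in> {a. a \<subseteq># m}. f a \<otimes>\<^bsub>R\<^esub> g (m - a))"
  "\<one>\<^bsub>mpoly_ring n R\<^esub> m = (if m = {#} then \<one>\<^bsub>R\<^esub> else \<zero>\<^bsub>R\<^esub>)"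
  "\<zero>\<^bsub>mpoly_ring n R\<^esub> m = \<zero>\<^bsub>R\<^esub>"
  "(f \<oplus>\<^bsub>mpoly_ring n R\<^esub> g) m = f m \<oplus>\<^bsub>R\<^esub> g m"
  by (simp_all add: mpoly_ring_def)

lemma (in ring) mpoly_abelian_group: "abelian_group (mpoly_ring n R)"
proof (rule abelian_groupI)
  fix f g assume f: "f \<in> carrier (mpoly_ring n R)" and g: "g \<in> carrier (mpoly_ring n R)"
  have "finite ({m. f m \<noteq> \<zero>} \<union> {m. g m \<noteq> \<zero>})" using f g by (auto simp: mpoly_ring_sel)
  moreover have "{m. f m \<oplus> g m \<noteq> \<zero>} \<subseteq> {m. f m \<noteq> \<zero>} \<union> {m. g m \<noteq> \<zero>}" by auto
  ultimately have "finite {m. f m \<oplus> g m \<noteq> \<zero>}" by (rule rev_finite_subset)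
  moreover have "set_mset m \<subseteq> {..<n}" if "f m \<oplus> g m \<noteq> \<zero>" for m
  proof -
    have "f m \<noteq> \<zero> \<or> g m \<noteq> \<zero>" using that by auto
    then show ?thesis using f g by (auto simp: mpoly_ring_sel)
  qed
  ultimately show "f \<oplus>\<^bsub>mpoly_ring n R\<^esub> g \<in> carrier (mpoly_ring n R)"
    using f g by (simp add: mpoly_ring_sel)
next
  fix f assume f: "f \<in> carrier (mpoly_ring n R)"
  have eq: "(\<ominus> f m \<noteq> \<zero>) = (f m \<noteq> \<zero>)" for m
    using f by (metis a_inv_closed minus_minus minus_zero mpoly_ring_sel(1))
  show "\<exists>g\<in>carrier (mpoly_ring n R). g \<oplus>\<^bsub>mpoly_ring n R\<^esub> f = \<zero>\<^bsub>mpoly_ring n R\<^esub>"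
    by (rule bexI[of _ "\<lambda>m. \<ominus> f m"])
       (use f eq in \<open>auto simp: mpoly_ring_sel fun_eq_iff l_neg\<close>)
qed (auto simp: mpoly_ring_sel fun_eq_iff intro: a_assoc a_comm)

text \<open>Taking one coefficient is additive. This moves a coefficient of a product in
  \<open>UP (mpoly_ring n R)\<close>, which is a sum of polynomials, down to a sum in
  \<open>R\<close>.\<close>

lemma (in ring) finsum_mpoly:
  assumes "finite S" "h \<in> S \<rightarrow> carrier (mpoly_ring n R)"
  shows "(\<Oplus>\<^bsub>mpoly_ring n R\<^esub>i\<in>S. h i) m = (\<Oplus>i\<in>S. h i m)"
proof -
  interpret M: abelian_group "mpoly_ring n R" by (rule mpoly_abelian_group)
  show ?thesis
    using assms
  proof (induction S)
    case empty
    then show ?case by (simp add: mpoly_ring_sel)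
  next
    case (insert x S)
    have "h x m \<in> carrier R" "(\<lambda>i. h i m) \<in> S \<rightarrow> carrier R"
      using insert.prems by (auto simp: mpoly_ring_sel(1) Pi_iff)
    then show ?case
      using insert by (simp add: M.finsum_insert finsum_insert Pi_iff mpoly_ring_sel(5))
  qed
qed

definition mpoly_const :: "('a, 'b) ring_scheme \<Rightarrow> 'a \<Rightarrow> nat multiset \<Rightarrow> 'a" where
  "mpoly_const R c m = (if m = {#} then c else \<zero>\<^bsub>R\<^esub>)"

lemma (in ring) mpoly_const_closed:
  assumes "c \<in> carrier R"
  shows "mpoly_const R c \<in> carrier (mpoly_ring n R)"
proof -
  have "{m. mpoly_const R c m \<noteq> \<zero>} \<subseteq> {{#}}" by (auto simp: mpoly_const_def)
  then have "finite {m. mpoly_const R c m \<noteq> \<zero>}" by (rule finite_subset) simp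
  then show ?thesis using assms by (auto simp: mpoly_ring_sel mpoly_const_def)
qed

lemma finite_submultisets: "finite {a. a \<subseteq># (m :: 'a multiset)}"
proof -
  have "{a. a \<subseteq># m} \<subseteq> mset ` {xs. set xs \<subseteq> set_mset m \<and> length xs \<le> size m}"
  proof
    fix a assume "a \<in> {a. a \<subseteq># m}"
    then have a: "a \<subseteq># m" by simp
    obtain xs where xs: "a = mset xs" by (metis ex_mset)
    have "set xs \<subseteq> set_mset m" "length xs \<le> size m"
      using a set_mset_mono[OF a] size_mset_mono[OF a] by (auto simp: xs)
    then show "a \<in> mset ` {xs. set xs \<subseteq> set_mset m \<and> length xs \<le> size m}" using xs by auto
  qed
  then show ?thesis by (rule finite_subset) (simp add: finite_lists_length_le)
qed

lemma (in ring) mpoly_const_mult: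
  assumes c: "c \<in> carrier R" and f: "f \<in> carrier (mpoly_ring n R)"
  shows "mpoly_const R c \<otimes>\<^bsub>mpoly_ring n R\<^esub> f = (\<lambda>m. c \<otimes> f m)"
proof
  fix m
  have fc: "f a \<in> carrier R" for a using f by (simp add: mpoly_ring_sel)
  have "(\<Oplus>a\<in>{a. a \<subseteq># m}. mpoly_const R c a \<otimes> f (m - a)) = (\<Oplus>a\<in>{a. a \<subseteq># m}. if {#} = a then c \<otimes> f (m - a) else \<zero>)"
    using c fc by (intro finsum_cong') (auto simp: mpoly_const_def)
  also have "\<dots> = c \<otimes> f (m - {#})"
    using c fc finite_submultisets[of m]
    by (subst add.finprod_singleton[where f = "\<lambda>a. c \<otimes> f (m - a)" and i = "{#}"]) auto
  finally show "(mpoly_const R c \<otimes>\<^bsub>mpoly_ring n R\<^esub> f) m = c \<otimes> f m"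
    by (simp add: mpoly_ring_sel)
qed

lemma (in ring) mpoly_const_iso: "mpoly_const R \<in> ring_iso R (mpoly_ring 0 R)"
proof (rule ring_iso_memI)
  fix c d assume c: "c \<in> carrier R" and d: "d \<in> carrier R"
  show "mpoly_const R c \<in> carrier (mpoly_ring 0 R)" using c by (rule mpoly_const_closed)
  show "mpoly_const R (c \<otimes> d) = mpoly_const R c \<otimes>\<^bsub>mpoly_ring 0 R\<^esub> mpoly_const R d"
    using c d by (auto simp: mpoly_const_mult mpoly_const_closed mpoly_const_def fun_eq_iff)
  show "mpoly_const R (c \<oplus> d) = mpoly_const R c \<oplus>\<^bsub>mpoly_ring 0 R\<^esub> mpoly_const R d"
    using c d by (auto simp: mpoly_ring_sel mpoly_const_def fun_eq_iff)
next
  show "mpoly_const R \<one> = \<one>\<^bsub>mpoly_ring 0 R\<^esub>"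
    by (auto simp: mpoly_ring_sel mpoly_const_def fun_eq_iff)
  show "bij_betw (mpoly_const R) (carrier R) (carrier (mpoly_ring 0 R))"
  proof (rule bij_betwI[where g = "\<lambda>f. f {#}"])
    fix f assume "f \<in> carrier (mpoly_ring 0 R)"
    then have "f m = \<zero>" if "m \<noteq> {#}" for m using that by (auto simp: mpoly_ring_sel)
    then show "mpoly_const R (f {#}) = f"
      by (auto simp: mpoly_const_def fun_eq_iff)
  qed (auto simp: mpoly_const_closed, auto simp: mpoly_const_def mpoly_ring_sel)
qed

text \<open>Presents \<open>n + 1\<close> variables as one outer indeterminate, the variable
  \<open>n\<close>, over the ring in the variables below \<open>n\<close>, so that arguments about
  polynomials in one indeterminate apply.\<close>

definition mpoly_of_UP :: "nat \<Rightarrow> (nat \<Rightarrow> nat multiset \<Rightarrow> 'a) \<Rightarrow> nat multiset \<Rightarrow> 'a" where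
  "mpoly_of_UP n f m = f (count m n) (filter_mset (\<lambda>x. x \<noteq> n) m)"

lemma filter_mset_add_replicate:
  "filter_mset (\<lambda>x. x \<noteq> n) m + replicate_mset (count m n) n = m"
  by (rule multiset_eqI) auto

text \<open>A divisor of a monomial is given by its exponent at \<open>n\<close> and, independently,
  by a divisor of the part free of \<open>n\<close>. This turns the convolution over monomials into
  the double convolution of the iterated polynomial ring.\<close>

lemma submultisets_split:
  fixes m :: "'a multiset" and n :: 'a
  defines "m' \<equiv> filter_mset (\<lambda>x. x \<noteq> n) m"
  shows "{a. a \<subseteq># m} = (\<Union>i\<in>{..count m n}. (\<lambda>b. b + replicate_mset i n) ` {b. b \<subseteq># m'})"
proof (intro equalityI subsetI)
  fix a assume "a \<in> {a. a \<subseteq># m}"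
  then have "count a n \<le> count m n" "filter_mset (\<lambda>x. x \<noteq> n) a \<subseteq># m'"
    unfolding m'_def by (auto simp: mset_subset_eq_count multiset_filter_mono)
  then show "a \<in> (\<Union>i\<in>{..count m n}. (\<lambda>b. b + replicate_mset i n) ` {b. b \<subseteq># m'})"
    by (intro UN_I[of "count a n"] image_eqI[of _ _ "filter_mset (\<lambda>x. x \<noteq> n) a"])
       (simp_all only: filter_mset_add_replicate atMost_iff mem_Collect_eq)
next
  fix a assume "a \<in> (\<Union>i\<in>{..count m n}. (\<lambda>b. b + replicate_mset i n) ` {b. b \<subseteq># m'})"
  then obtain i b where ib: "i \<le> count m n" "b \<subseteq># m'" "a = b + replicate_mset i n" by auto
  have "b + replicate_mset i n \<subseteq># m' + replicate_mset (count m n) n"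
    using ib by (intro subset_mset.add_mono) (auto simp: subseteq_mset_def)
  then show "a \<in> {a. a \<subseteq># m}" using ib by (simp add: m'_def filter_mset_add_replicate)
qed

lemma (in ring) mpoly_of_UP_iso:
  assumes ring: "ring (mpoly_ring n R)"
  shows "mpoly_of_UP n \<in> ring_iso (UP (mpoly_ring n R)) (mpoly_ring (Suc n) R)"
proof (rule ring_iso_memI)
  interpret M: ring "mpoly_ring n R" by (rule ring)
  interpret P: UP_ring "mpoly_ring n R" "UP (mpoly_ring n R)" by unfold_locales auto
  have car: "f \<in> carrier (UP (mpoly_ring n R)) \<longleftrightarrow> f \<in> up (mpoly_ring n R)" for f
    by (simp add: UP_def)
  {
    fix f assume "f \<in> carrier (UP (mpoly_ring n R))"
    then have f: "f \<in> up (mpoly_ring n R)" by (simp add: UP_def)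
    then obtain N where N: "bound \<zero>\<^bsub>mpoly_ring n R\<^esub> N f" by auto
    have fi: "f i \<in> carrier (mpoly_ring n R)" for i using f by auto
    have f0: "f i m = \<zero>" if "i > N" for i m
      using N that by (auto simp: bound_def mpoly_ring_sel)
    let ?S = "\<Union>i\<le>N. (\<lambda>b. b + replicate_mset i n) ` {m. f i m \<noteq> \<zero>}"
    have "{m. mpoly_of_UP n f m \<noteq> \<zero>} \<subseteq> ?S"
    proof
      fix m assume "m \<in> {m. mpoly_of_UP n f m \<noteq> \<zero>}"
      then have *: "f (count m n) (filter_mset (\<lambda>x. x \<noteq> n) m) \<noteq> \<zero>" by (simp add: mpoly_of_UP_def)
      then have "count m n \<le> N" using f0 by (meson not_le)
      with * show "m \<in> ?S"
        by (intro UN_I[of "count m n"] image_eqI[of _ _ "filter_mset (\<lambda>x. x \<noteq> n) m"])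
           (simp_all only: filter_mset_add_replicate atMost_iff mem_Collect_eq not_False_eq_True)
    qed
    moreover have "finite ?S" using fi by (auto simp: mpoly_ring_sel)
    ultimately have fin: "finite {m. mpoly_of_UP n f m \<noteq> \<zero>}" by (rule finite_subset)
    have "set_mset m \<subseteq> {..<Suc n}" if "mpoly_of_UP n f m \<noteq> \<zero>" for m
    proof -
      have "set_mset (filter_mset (\<lambda>x. x \<noteq> n) m) \<subseteq> {..<n}"
        using that fi unfolding mpoly_of_UP_def mpoly_ring_sel by blast
      then show ?thesis by (force simp: less_Suc_eq)
    qed
    with fin fi show "mpoly_of_UP n f \<in> carrier (mpoly_ring (Suc n) R)"
      by (auto simp: mpoly_ring_sel mpoly_of_UP_def)
  } note closed = this
  {
    fix f g assume "f \<in> carrier (UP (mpoly_ring n R))" "g \<in> carrier (UP (mpoly_ring n R))"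
    then have f: "f \<in> up (mpoly_ring n R)" and g: "g \<in> up (mpoly_ring n R)" by (simp_all add: UP_def)
    show "mpoly_of_UP n (f \<oplus>\<^bsub>UP (mpoly_ring n R)\<^esub> g) =
        mpoly_of_UP n f \<oplus>\<^bsub>mpoly_ring (Suc n) R\<^esub> mpoly_of_UP n g"
      using f g by (auto simp: UP_def mpoly_of_UP_def mpoly_ring_sel fun_eq_iff)
    have fi: "f i \<in> carrier (mpoly_ring n R)" and gi: "g i \<in> carrier (mpoly_ring n R)" for i
      using f g by auto
    then have fc: "f i m \<in> carrier R" and gc: "g i m \<in> carrier R" for i m
      by (auto simp: mpoly_ring_sel)
    show "mpoly_of_UP n (f \<otimes>\<^bsub>UP (mpoly_ring n R)\<^esub> g) =
        mpoly_of_UP n f \<otimes>\<^bsub>mpoly_ring (Suc n) R\<^esub> mpoly_of_UP n g"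
    proof
      fix m
      define m' where "m' = filter_mset (\<lambda>x. x \<noteq> n) m"
      define k where "k = count m n"
      let ?F = "mpoly_of_UP n f" and ?G = "mpoly_of_UP n g"
      have FG: "?F a \<in> carrier R" "?G a \<in> carrier R" for a
        using fc gc by (auto simp: mpoly_of_UP_def)
      have n_b: "n \<notin># b" if "b \<subseteq># m'" for b
        using that mset_subset_eqD[of b m' n] by (auto simp: m'_def)
      have cnt: "count (b + replicate_mset i n) n = i"
        "filter_mset (\<lambda>x. x \<noteq> n) (b + replicate_mset i n) = b" if "b \<subseteq># m'" for i b
        using n_b[OF that] by (auto simp: not_in_iff intro!: multiset_eqI)
      have inj: "inj_on (\<lambda>b. b + replicate_mset i n) A" for i A by (auto simp: inj_on_def)
      have "(?F \<otimes>\<^bsub>mpoly_ring (Suc n) R\<^esub> ?G) m = (\<Oplus>a \<in> {a. a \<subseteq># m}. ?F a \<otimes> ?G (m - a))"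
        by (simp add: mpoly_ring_sel)
      also have "\<dots> = (\<Oplus>i\<in>{..k}. \<Oplus>a\<in>(\<lambda>b. b + replicate_mset i n) ` {b. b \<subseteq># m'}. ?F a \<otimes> ?G (m - a))"
        unfolding submultisets_split[of m n] m'_def[symmetric] k_def[symmetric]
      proof (rule add.finprod_UN_disjoint)
        show "pairwise (\<lambda>i j. disjnt ((\<lambda>b. b + replicate_mset i n) ` {b. b \<subseteq># m'})
              ((\<lambda>b. b + replicate_mset j n) ` {b. b \<subseteq># m'})) {..k}"
          unfolding pairwise_def disjnt_iff by (metis (no_types, lifting) cnt(1) image_iff mem_Collect_eq)
      qed (use FG finite_submultisets[of m'] in auto)
      also have "\<dots> = (\<Oplus>i\<in>{..k}. \<Oplus>b\<in>{b. b \<subseteq># m'}. f i b \<otimes> g (k - i) (m' - b))"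
      proof (rule finsum_cong'[OF refl])
        fix i assume i: "i \<in> {..k}"
        have "(\<Oplus>a\<in>(\<lambda>b. b + replicate_mset i n) ` {b. b \<subseteq># m'}. ?F a \<otimes> ?G (m - a)) =
            (\<Oplus>b\<in>{b. b \<subseteq># m'}. ?F (b + replicate_mset i n) \<otimes> ?G (m - (b + replicate_mset i n)))"
          using FG by (intro finsum_reindex inj) auto
        also have "\<dots> = (\<Oplus>b\<in>{b. b \<subseteq># m'}. f i b \<otimes> g (k - i) (m' - b))"
        proof (rule finsum_cong'[OF refl])
          fix b assume "b \<in> {b. b \<subseteq># m'}"
          then have b: "b \<subseteq># m'" by simp
          have "m - (b + replicate_mset i n) = (m' - b) + replicate_mset (k - i) n"
            using i b n_b[OF b]
            by (intro multiset_eqI) (auto simp: m'_def k_def not_in_iff)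
          then show "?F (b + replicate_mset i n) \<otimes> ?G (m - (b + replicate_mset i n)) =
              f i b \<otimes> g (k - i) (m' - b)"
            using cnt[OF b] cnt[of "m' - b"] by (simp add: mpoly_of_UP_def)
        qed (use fc gc in auto)
        finally show "(\<Oplus>a\<in>(\<lambda>b. b + replicate_mset i n) ` {b. b \<subseteq># m'}. ?F a \<otimes> ?G (m - a)) =
          (\<Oplus>b\<in>{b. b \<subseteq># m'}. f i b \<otimes> g (k - i) (m' - b))" .
      qed (use fc gc in \<open>auto intro!: finsum_closed\<close>)
      also have "\<dots> = (\<Oplus>i\<in>{..k}. (f i \<otimes>\<^bsub>mpoly_ring n R\<^esub> g (k - i)) m')"
        by (simp add: mpoly_ring_sel)
      also have "\<dots> = (\<Oplus>\<^bsub>mpoly_ring n R\<^esub>i\<in>{..k}. f i \<otimes>\<^bsub>mpoly_ring n R\<^esub> g (k - i)) m'"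
        using fi gi by (subst finsum_mpoly) auto
      also have "\<dots> = mpoly_of_UP n (f \<otimes>\<^bsub>UP (mpoly_ring n R)\<^esub> g) m"
        using f g by (simp add: mpoly_of_UP_def UP_def m'_def k_def)
      finally show "mpoly_of_UP n (f \<otimes>\<^bsub>UP (mpoly_ring n R)\<^esub> g) m = (?F \<otimes>\<^bsub>mpoly_ring (Suc n) R\<^esub> ?G) m" ..
    qed
  }
  show "mpoly_of_UP n \<one>\<^bsub>UP (mpoly_ring n R)\<^esub> = \<one>\<^bsub>mpoly_ring (Suc n) R\<^esub>"
  proof
    fix m
    have "count m n = 0 \<and> filter_mset (\<lambda>x. x \<noteq> n) m = {#} \<longleftrightarrow> m = {#}"
      using filter_mset_add_replicate[of n m] by (metis add_0 count_empty filter_empty_mset replicate_mset_0)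
    then show "mpoly_of_UP n \<one>\<^bsub>UP (mpoly_ring n R)\<^esub> m = \<one>\<^bsub>mpoly_ring (Suc n) R\<^esub> m"
      by (cases "count m n = 0"; cases "filter_mset (\<lambda>x. x \<noteq> n) m = {#}")
         (simp_all only: mpoly_of_UP_def UP_def mpoly_ring_sel partial_object.simps monoid.simps if_True if_False simp_thms ring.simps cong: if_cong)
  qed
  show "bij_betw (mpoly_of_UP n) (carrier (UP (mpoly_ring n R))) (carrier (mpoly_ring (Suc n) R))"
  \<comment> \<open>The inverse collects the terms with exponent \<open>k\<close> at the variable
    \<open>n\<close>. The test \<open>n \<in># m\<close> keeps the coefficients inside
    \<open>mpoly_ring n R\<close>; without it, terms of higher degree in that variable would be
    picked up too.\<close>
  proof (rule bij_betwI[where g = "\<lambda>f k m. if n \<in># m then \<zero> else f (m + replicate_mset k n)"])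
    show "mpoly_of_UP n \<in> carrier (UP (mpoly_ring n R)) \<rightarrow> carrier (mpoly_ring (Suc n) R)"
      using closed by auto
    show "(\<lambda>f k m. if n \<in># m then \<zero> else f (m + replicate_mset k n)) \<in>
        carrier (mpoly_ring (Suc n) R) \<rightarrow> carrier (UP (mpoly_ring n R))"
    proof
      fix f assume f: "f \<in> carrier (mpoly_ring (Suc n) R)"
      let ?h = "\<lambda>k m. if n \<in># m then \<zero> else f (m + replicate_mset k n)"
      have hk: "?h k \<in> carrier (mpoly_ring n R)" for k
      proof -
        have "(\<lambda>m. m + replicate_mset k n) ` {m. ?h k m \<noteq> \<zero>} \<subseteq> {m. f m \<noteq> \<zero>}" by auto
        then have "finite ((\<lambda>m. m + replicate_mset k n) ` {m. ?h k m \<noteq> \<zero>})"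
          by (rule finite_subset) (use f in \<open>simp add: mpoly_ring_sel\<close>)
        then have "finite {m. ?h k m \<noteq> \<zero>}" by (rule finite_imageD) (auto simp: inj_on_def)
        moreover have "set_mset m \<subseteq> {..<n}" if "?h k m \<noteq> \<zero>" for m
        proof -
          have n: "n \<notin># m" and "f (m + replicate_mset k n) \<noteq> \<zero>"
            using that by (auto split: if_splits)
          then have "set_mset (m + replicate_mset k n) \<subseteq> {..<Suc n}"
            using f unfolding mpoly_ring_sel by blast
          with n show ?thesis by (auto simp: less_Suc_eq)
        qed
        ultimately show ?thesis using f by (simp add: mpoly_ring_sel)
      qed
      have "\<exists>N. bound \<zero>\<^bsub>mpoly_ring n R\<^esub> N ?h"
      proof -
        define N where "N = Max (insert 0 (size ` {m. f m \<noteq> \<zero>}))"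
        have "f m = \<zero>" if "size m > N" for m
        proof (rule ccontr)
          assume "f m \<noteq> \<zero>"
          then have "size m \<le> N" unfolding N_def
            using f by (intro Max_ge) (auto simp: mpoly_ring_sel)
          then show False using that by simp
        qed
        then have "bound \<zero>\<^bsub>mpoly_ring n R\<^esub> N ?h"
          by (auto simp: bound_def fun_eq_iff mpoly_ring_sel)
        then show ?thesis by blast
      qed
      with hk show "?h \<in> carrier (UP (mpoly_ring n R))" by (auto simp: car)
    qed
  next
    fix f assume f: "f \<in> carrier (mpoly_ring (Suc n) R)"
    show "mpoly_of_UP n (\<lambda>k m. if n \<in># m then \<zero> else f (m + replicate_mset k n)) = f"
      by (auto simp: mpoly_of_UP_def fun_eq_iff filter_mset_add_replicate)
  next
    fix f assume "f \<in> carrier (UP (mpoly_ring n R))"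
    then have fk: "f k \<in> carrier (mpoly_ring n R)" for k by (auto simp: UP_def)
    then have "f k m = \<zero>" if "n \<in># m" for k m
      using that by (auto simp: mpoly_ring_sel)
    moreover have "count (m + replicate_mset k n) n = k \<and>
        filter_mset (\<lambda>x. x \<noteq> n) (m + replicate_mset k n) = m" if "n \<notin># m" for k m
      using that by (auto simp: not_in_iff intro!: multiset_eqI)
    ultimately show "(\<lambda>k m. if n \<in># m then \<zero> else mpoly_of_UP n f (m + replicate_mset k n)) = f"
      by (auto simp: fun_eq_iff mpoly_of_UP_def)
  qed
qed

text \<open>Transport of the domain property along a ring isomorphism yields the target with its
  zero replaced by the image of zero; here that is no change.\<close>

lemma mpoly_ring_zero_update:
  "mpoly_ring n R \<lparr>zero := \<lambda>m. \<zero>\<^bsub>R\<^esub>\<rparr> = mpoly_ring n R"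
  by (simp add: mpoly_ring_def)

lemma (in domain) mpoly_domain: "domain (mpoly_ring n R)"
proof (induction n)
  case 0
  have "mpoly_const R \<zero> = (\<lambda>m. \<zero>)" by (auto simp: mpoly_const_def)
  then show ?case
    using ring_iso_imp_img_domain[OF mpoly_const_iso] by (simp add: mpoly_ring_zero_update)
next
  case (Suc n)
  interpret M: domain "mpoly_ring n R" by (rule Suc)
  interpret P: UP_domain "mpoly_ring n R" "UP (mpoly_ring n R)" by unfold_locales auto
  have "mpoly_of_UP n \<zero>\<^bsub>UP (mpoly_ring n R)\<^esub> = (\<lambda>m. \<zero>)"
    by (auto simp: mpoly_of_UP_def UP_def mpoly_ring_sel)
  then show ?case
    using P.ring_iso_imp_img_domain[OF mpoly_of_UP_iso[OF M.ring_axioms]]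
    by (simp add: mpoly_ring_zero_update)
qed


section \<open>Total degree and its additivity\<close>

lemma size_le_total_degree:
  assumes "f \<in> carrier (mpoly_ring n R)" "f m \<noteq> \<zero>\<^bsub>R\<^esub>"
  shows "size m \<le> total_degree R f"
  unfolding total_degree_def using assms by (intro Max_ge) (auto simp: mpoly_ring_sel)

lemma total_degree_attained:
  assumes "f \<in> carrier (mpoly_ring n R)" "f \<noteq> \<zero>\<^bsub>mpoly_ring n R\<^esub>"
  obtains m where "f m \<noteq> \<zero>\<^bsub>R\<^esub>" "size m = total_degree R f"
proof -
  have "{m. f m \<noteq> \<zero>\<^bsub>R\<^esub>} \<noteq> {}" using assms(2) by (auto simp: mpoly_ring_sel fun_eq_iff)
  moreover have "finite {m. f m \<noteq> \<zero>\<^bsub>R\<^esub>}" using assms(1) by (simp add: mpoly_ring_sel)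
  ultimately have "total_degree R f \<in> size ` {m. f m \<noteq> \<zero>\<^bsub>R\<^esub>}"
    unfolding total_degree_def by (intro Max_in) auto
  then show ?thesis using that by auto
qed

lemma total_degree_le_iff:
  assumes "f \<in> carrier (mpoly_ring n R)" "f \<noteq> \<zero>\<^bsub>mpoly_ring n R\<^esub>"
  shows "total_degree R f \<le> d \<longleftrightarrow> (\<forall>m. f m \<noteq> \<zero>\<^bsub>R\<^esub> \<longrightarrow> size m \<le> d)"
  by (metis assms le_trans size_le_total_degree total_degree_attained)

text \<open>The product of the leading homogeneous parts is the part of the product in the expected
  degree, and it is nonzero because the ring of polynomials is a domain.\<close>

lemma (in domain) total_degree_mult:
  assumes f: "f \<in> carrier (mpoly_ring n R)" "f \<noteq> \<zero>\<^bsub>mpoly_ring n R\<^esub>"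
    and g: "g \<in> carrier (mpoly_ring n R)" "g \<noteq> \<zero>\<^bsub>mpoly_ring n R\<^esub>"
  shows "total_degree R (f \<otimes>\<^bsub>mpoly_ring n R\<^esub> g) = total_degree R f + total_degree R g"
proof -
  interpret M: domain "mpoly_ring n R" by (rule mpoly_domain)
  define d e where "d = total_degree R f" and "e = total_degree R g"
  define top where "top c h = (\<lambda>m :: nat multiset. if size m = c then h m else \<zero>)" for c h
  have top_closed: "top c h \<in> carrier (mpoly_ring n R)" if "h \<in> carrier (mpoly_ring n R)" for c h
  proof -
    have "finite {m. top c h m \<noteq> \<zero>}"
      by (rule finite_subset[of _ "{m. h m \<noteq> \<zero>}"]) (use that in \<open>auto simp: mpoly_ring_sel top_def\<close>)
    then show ?thesis using that by (auto simp: mpoly_ring_sel top_def)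
  qed
  have top_nz: "top (total_degree R h) h \<noteq> \<zero>\<^bsub>mpoly_ring n R\<^esub>"
    if h: "h \<in> carrier (mpoly_ring n R)" "h \<noteq> \<zero>\<^bsub>mpoly_ring n R\<^esub>" for h
  proof -
    obtain m where "h m \<noteq> \<zero>" "size m = total_degree R h" using total_degree_attained[OF h] .
    then show ?thesis unfolding top_def mpoly_ring_def by (auto simp: fun_eq_iff)
  qed
  have fc: "f m \<in> carrier R" and gc: "g m \<in> carrier R" for m using f g by (auto simp: mpoly_ring_sel)
  have tc: "top d f m \<in> carrier R" "top e g m \<in> carrier R" for m using fc gc by (auto simp: top_def)
  have f0: "f m = \<zero>" if "size m > d" for m
    using that size_le_total_degree[OF f(1), of m] by (auto simp: d_def)
  have g0: "g m = \<zero>" if "size m > e" for m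
    using that size_le_total_degree[OF g(1), of m] by (auto simp: e_def)
  \<comment> \<open>If the sizes of the two factors add up to at least \<open>d + e\<close>, one of
    them exceeds its bound unless both are attained. Equality serves to compare the top parts,
    strict excess to bound the degree from above.\<close>
  have split: "f a \<otimes> g (m - a) = \<zero> \<or> size a = d \<and> size (m - a) = e"
    if am: "a \<subseteq># m" "size m \<ge> d + e" for a m
  proof -
    have "size m = size a + size (m - a)" using am by (simp add: size_Diff_submset size_mset_mono)
    then consider "size a > d" | "size (m - a) > e" | "size a = d \<and> size (m - a) = e"
      using am by linarith
    then show ?thesis using f0 g0 fc gc by cases auto
  qed
  have prod_eq: "(f \<otimes>\<^bsub>mpoly_ring n R\<^esub> g) m = (top d f \<otimes>\<^bsub>mpoly_ring n R\<^esub> top e g) m"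
    if "size m = d + e" for m
    unfolding mpoly_ring_sel
  proof (rule finsum_cong'[OF refl])
    fix a assume "a \<in> {a. a \<subseteq># m}"
    then have a: "a \<subseteq># m" by simp
    have "size m = size a + size (m - a)" using a by (simp add: size_Diff_submset size_mset_mono)
    then have *: "size a = d \<longleftrightarrow> size (m - a) = e" using that by linarith
    show "f a \<otimes> g (m - a) = top d f a \<otimes> top e g (m - a)"
      using split[OF a] that * fc gc by (auto simp: top_def)
  qed (use tc in auto)
  have "top d f \<otimes>\<^bsub>mpoly_ring n R\<^esub> top e g \<noteq> \<zero>\<^bsub>mpoly_ring n R\<^esub>"
    using M.integral_iff[OF top_closed[OF f(1)] top_closed[OF g(1)]] top_nz[OF f] top_nz[OF g]
    by (simp add: d_def e_def)
  then obtain m where m: "(top d f \<otimes>\<^bsub>mpoly_ring n R\<^esub> top e g) m \<noteq> \<zero>"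
    by (auto simp: fun_eq_iff mpoly_ring_sel(4))
  have size_m: "size m = d + e"
  proof (rule ccontr)
    assume *: "size m \<noteq> d + e"
    have "top d f a \<otimes> top e g (m - a) = \<zero>" if "a \<subseteq># m" for a
    proof -
      have "size m = size a + size (m - a)" using that by (simp add: size_Diff_submset size_mset_mono)
      then have "size a \<noteq> d \<or> size (m - a) \<noteq> e" using * by auto
      then show ?thesis using fc gc by (auto simp: top_def)
    qed
    then have "(\<Oplus>a\<in>{a. a \<subseteq># m}. top d f a \<otimes> top e g (m - a)) = \<zero>"
      by (intro add.finprod_one_eqI) auto
    then show False using m by (simp add: mpoly_ring_sel)
  qed
  have nz: "f \<otimes>\<^bsub>mpoly_ring n R\<^esub> g \<noteq> \<zero>\<^bsub>mpoly_ring n R\<^esub>"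
    using M.integral_iff f g by simp
  show ?thesis
  proof (rule antisym)
    have "(f \<otimes>\<^bsub>mpoly_ring n R\<^esub> g) m = \<zero>" if "size m > d + e" for m
      unfolding mpoly_ring_sel
    proof (rule add.finprod_one_eqI)
      fix a assume "a \<in> {a. a \<subseteq># m}"
      then have a: "a \<subseteq># m" by simp
      have "size m = size a + size (m - a)" using a by (simp add: size_Diff_submset size_mset_mono)
      then show "f a \<otimes> g (m - a) = \<zero>" using split[OF a] that by auto
    qed
    then show "total_degree R (f \<otimes>\<^bsub>mpoly_ring n R\<^esub> g) \<le> total_degree R f + total_degree R g"
      using total_degree_le_iff[OF M.m_closed[OF f(1) g(1)] nz] by (force simp: d_def e_def not_le)
    have "(f \<otimes>\<^bsub>mpoly_ring n R\<^esub> g) m \<noteq> \<zero>" using m prod_eq[OF size_m] by simp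
    then show "total_degree R f + total_degree R g \<le> total_degree R (f \<otimes>\<^bsub>mpoly_ring n R\<^esub> g)"
      using size_le_total_degree[OF M.m_closed[OF f(1) g(1)], of m] size_m by (simp add: d_def e_def)
  qed
qed

lemma total_degree_0_imp_const:
  assumes "f \<in> carrier (mpoly_ring n R)" "f \<noteq> \<zero>\<^bsub>mpoly_ring n R\<^esub>" "total_degree R f = 0"
  obtains c where "c \<in> carrier R" "c \<noteq> \<zero>\<^bsub>R\<^esub>" "f = mpoly_const R c"
proof
  show "f {#} \<in> carrier R" using assms by (simp add: mpoly_ring_sel)
  have "f m = \<zero>\<^bsub>R\<^esub>" if "m \<noteq> {#}" for m
    using size_le_total_degree[OF assms(1), of m] assms(3) that by auto
  then show *: "f = mpoly_const R (f {#})" by (auto simp: mpoly_const_def)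
  show "f {#} \<noteq> \<zero>\<^bsub>R\<^esub>"
  proof
    assume "f {#} = \<zero>\<^bsub>R\<^esub>"
    then have "f = \<zero>\<^bsub>mpoly_ring n R\<^esub>" using * by (auto simp: mpoly_ring_def mpoly_const_def fun_eq_iff)
    then show False using assms(2) by simp
  qed
qed

lemma (in field) mpoly_const_Unit:
  assumes "c \<in> carrier R" "c \<noteq> \<zero>"
  shows "mpoly_const R c \<in> Units (mpoly_ring n R)"
proof -
  interpret M: domain "mpoly_ring n R" by (rule mpoly_domain)
  have c: "c \<in> Units R" using assms by (simp add: field_Units)
  have "mpoly_const R c \<otimes>\<^bsub>mpoly_ring n R\<^esub> mpoly_const R (inv c) = \<one>\<^bsub>mpoly_ring n R\<^esub>"
    using c by (subst mpoly_const_mult[OF _ mpoly_const_closed])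
      (auto simp: fun_eq_iff mpoly_const_def mpoly_ring_sel)
  then show ?thesis
    using c M.divides_one[OF mpoly_const_closed] mpoly_const_closed[of "inv c"]
    by (metis Units_closed Units_inv_closed dividesI)
qed

section \<open>Unique factorization\<close>

hide_const (open) Polynomial.monom Polynomial.coeff

section \<open>Divisibility, degrees and Gauss's lemma\<close>

lemma (in cring) divides_add:
  assumes "a divides x" "a divides y" "a \<in> carrier R"
  shows "a divides (x \<oplus> y)"
proof -
  obtain b c where "b \<in> carrier R" "x = a \<otimes> b" "c \<in> carrier R" "y = a \<otimes> c"
    using assms unfolding factor_def by auto
  then show ?thesis using assms by (intro dividesI[of "b \<oplus> c"]) (auto simp: r_distr)
qed

lemma (in cring) divides_uminus:
  assumes "a divides x" "a \<in> carrier R"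
  shows "a divides (\<ominus> x)"
proof -
  obtain b where "b \<in> carrier R" "x = a \<otimes> b"
    using assms unfolding factor_def by auto
  then show ?thesis using assms by (intro dividesI[of "\<ominus> b"]) (auto simp: r_minus)
qed

lemma (in cring) divides_mult_right:
  assumes "a divides x" "a \<in> carrier R" "y \<in> carrier R"
  shows "a divides (x \<otimes> y)"
proof -
  obtain b where "b \<in> carrier R" "x = a \<otimes> b"
    using assms unfolding factor_def by auto
  then show ?thesis using assms by (intro dividesI[of "b \<otimes> y"]) (auto simp: m_assoc)
qed

lemma (in cring) divides_mult_left:
  assumes "a divides x" "a \<in> carrier R" "x \<in> carrier R" "y \<in> carrier R"
  shows "a divides (y \<otimes> x)"
  using divides_mult_right[OF assms(1,2,4)] assms(3,4) by (simp add: m_comm)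

lemma (in cring) divides_finsum:
  assumes "a \<in> carrier R" "\<And>i. i \<in> I \<Longrightarrow> f i \<in> carrier R \<and> a divides (f i)"
  shows "a divides (\<Oplus>i\<in>I. f i)"
  using assms(2)
proof (induction I rule: infinite_finite_induct)
  case (insert i I)
  then show ?case
    by (subst finsum_insert) (auto intro!: divides_add assms(1))
qed (use assms(1) in \<open>auto simp: divides_zero finsum_infinite\<close>)

lemma (in cring) divides_add_cancel:
  assumes "a divides (x \<oplus> y)" "a divides y" "a \<in> carrier R" "x \<in> carrier R" "y \<in> carrier R"
  shows "a divides x"
proof -
  have "a divides ((x \<oplus> y) \<oplus> \<ominus> y)"
    by (intro divides_add[OF assms(1) divides_uminus[OF assms(2,3)] assms(3)])
  also have "(x \<oplus> y) \<oplus> \<ominus> y = x" using assms(4,5) by (simp add: a_assoc r_neg)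
  finally show ?thesis .
qed

text \<open>The features of the total degree on which factorization rests: a proper factor has
  smaller degree, so the degree serves as induction measure.\<close>

locale degree_domain = domain R for R (structure) +
  fixes \<delta> :: "'a \<Rightarrow> nat"
  assumes degree_mult:
      "\<lbrakk>a \<in> carrier R; b \<in> carrier R; a \<noteq> \<zero>; b \<noteq> \<zero>\<rbrakk> \<Longrightarrow> \<delta> (a \<otimes> b) = \<delta> a + \<delta> b"
    and degree_0_imp_Unit: "\<lbrakk>a \<in> carrier R; a \<noteq> \<zero>; \<delta> a = 0\<rbrakk> \<Longrightarrow> a \<in> Units R"
begin

lemma Unit_nonzero: "u \<in> Units R \<Longrightarrow> u \<noteq> \<zero>"
  using Units_r_inv_ex l_null one_not_zero by metis

lemma degree_one: "\<delta> \<one> = 0"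
  using degree_mult[of \<one> \<one>] by simp

lemma degree_Unit: assumes "u \<in> Units R" shows "\<delta> u = 0"
proof -
  have "\<delta> (u \<otimes> inv u) = \<delta> u + \<delta> (inv u)"
    using assms by (intro degree_mult) (auto simp: Unit_nonzero)
  then show ?thesis using assms by (simp add: degree_one)
qed

lemma irreducible_factor_exists:
  assumes "a \<in> carrier R" "a \<noteq> \<zero>" "a \<notin> Units R"
  obtains \<pi> b where "\<pi> \<in> carrier R" "ring_irreducible \<pi>" "b \<in> carrier R" "a = \<pi> \<otimes> b"
proof -
  have "\<exists>\<pi> b. \<pi> \<in> carrier R \<and> ring_irreducible \<pi> \<and> b \<in> carrier R \<and> a = \<pi> \<otimes> b"
    using assms
  proof (induction "\<delta> a" arbitrary: a rule: less_induct)
    case less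
    show ?case
    proof (cases "ring_irreducible a")
      case True
      then show ?thesis using less.prems by (intro exI[of _ a] exI[of _ \<one>]) auto
    next
      case False
      then obtain x y where xy: "x \<in> carrier R" "y \<in> carrier R" "a = x \<otimes> y" "x \<notin> Units R" "y \<notin> Units R"
        using ring_irreducibleI[of a] less.prems by blast
      then have nz: "x \<noteq> \<zero>" "y \<noteq> \<zero>" using less.prems by auto
      then have "\<delta> x < \<delta> a" using xy degree_0_imp_Unit[of y] by (auto simp: degree_mult)
      then obtain \<pi> b where "\<pi> \<in> carrier R" "ring_irreducible \<pi>" "b \<in> carrier R" "x = \<pi> \<otimes> b"
        using less.hyps[of x] xy nz by blast
      then show ?thesis using xy by (intro exI[of _ \<pi>] exI[of _ "b \<otimes> y"]) (auto simp: m_assoc)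
    qed
  qed
  then show ?thesis using that by blast
qed

end

text \<open>Existence of factorizations comes from the degree, uniqueness from irreducibles being
  prime; together this is unique factorization.\<close>

locale degree_ufd = degree_domain R \<delta> for R (structure) and \<delta> +
  assumes irreducible_imp_prime: "\<lbrakk>a \<in> carrier R; ring_irreducible a\<rbrakk> \<Longrightarrow> ring_prime a"

text \<open>Here \<open>\<delta>\<close> is a degree on the coefficient ring \<open>R\<close>; the
  degree of elements of \<open>P\<close> in the new indeterminate is \<open>deg R\<close>.\<close>

locale UP_degree_ufd = UP_domain R P + degree_ufd R \<delta>
  for R (structure) and P (structure) and \<delta>
begin

abbreviation const where "const a \<equiv> monom P a 0"

lemma domain_P: "domain P" by (rule UP_domain)

lemma smult_conv_const: "\<lbrakk>a \<in> carrier R; f \<in> carrier P\<rbrakk> \<Longrightarrow> a \<odot>\<^bsub>P\<^esub> f = const a \<otimes>\<^bsub>P\<^esub> f"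
  by (simp add: monom_mult_is_smult)

lemma const_divides_iff:
  assumes a: "a \<in> carrier R" and f: "f \<in> carrier P"
  shows "const a divides\<^bsub>P\<^esub> f \<longleftrightarrow> (\<forall>k. a divides\<^bsub>R\<^esub> coeff P f k)"
proof
  assume "const a divides\<^bsub>P\<^esub> f"
  then obtain g where g: "g \<in> carrier P" "f = const a \<otimes>\<^bsub>P\<^esub> g" unfolding factor_def by auto
  then have "coeff P f k = a \<otimes> coeff P g k" for k using a by (simp add: monom_mult_is_smult del: coeff_mult)
  then show "\<forall>k. a divides\<^bsub>R\<^esub> coeff P f k" using coeff_closed[OF g(1)] unfolding factor_def by blast
next
  assume *: "\<forall>k. a divides\<^bsub>R\<^esub> coeff P f k"
  \<comment> \<open>Taking the quotient 0 at zero coefficients makes the quotient polynomial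
    finitely supported, even for \<open>a = \<zero>\<close>.\<close>
  have "\<exists>b. b \<in> carrier R \<and> coeff P f k = a \<otimes> b \<and> (coeff P f k = \<zero> \<longrightarrow> b = \<zero>)" for k
  proof (cases "coeff P f k = \<zero>")
    case False
    then show ?thesis using * unfolding factor_def by blast
  qed (use a in auto)
  then obtain b where b: "\<And>k. b k \<in> carrier R" "\<And>k. coeff P f k = a \<otimes> b k"
    "\<And>k. coeff P f k = \<zero> \<Longrightarrow> b k = \<zero>" by metis
  have "bound \<zero> (deg R f) b" using b(3) deg_aboveD[OF _ f] by auto
  then have "b \<in> up R" using b(1) by auto
  then have b_P: "b \<in> carrier P" and cb: "coeff P b k = b k" for k by (auto simp: P_def UP_def)
  have "f = const a \<otimes>\<^bsub>P\<^esub> b"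
    unfolding smult_conv_const[OF a b_P, symmetric] using a b_P f b(2) cb
    by (intro up_eqI) auto
  then show "const a divides\<^bsub>P\<^esub> f" by (rule dividesI[OF b_P])
qed

text \<open>The coefficient in degree \<open>i + j\<close> of \<open>f g\<close> is not divisible by \<open>p\<close> when \<open>i\<close> and \<open>j\<close> are
  the least indices of coefficients of \<open>f\<close> and \<open>g\<close> not divisible by \<open>p\<close>.\<close>

lemma const_prime:
  assumes p: "p \<in> carrier R" "ring_prime\<^bsub>R\<^esub> p" and f: "f \<in> carrier P" and g: "g \<in> carrier P"
    and dvd: "const p divides\<^bsub>P\<^esub> (f \<otimes>\<^bsub>P\<^esub> g)"
  shows "const p divides\<^bsub>P\<^esub> f \<or> const p divides\<^bsub>P\<^esub> g"
proof (rule ccontr)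
  assume "\<not> ?thesis"
  then have ex: "\<exists>k. \<not> p divides\<^bsub>R\<^esub> coeff P f k" "\<exists>k. \<not> p divides\<^bsub>R\<^esub> coeff P g k"
    using p f g by (auto simp: const_divides_iff)
  define i where "i = (LEAST k. \<not> p divides\<^bsub>R\<^esub> coeff P f k)"
  define j where "j = (LEAST k. \<not> p divides\<^bsub>R\<^esub> coeff P g k)"
  have i: "\<not> p divides\<^bsub>R\<^esub> coeff P f i" unfolding i_def using ex(1) by (rule LeastI_ex)
  have less_i: "p divides\<^bsub>R\<^esub> coeff P f k" if "k < i" for k
    using not_less_Least[OF that[unfolded i_def]] by (rule notnotD)
  have j: "\<not> p divides\<^bsub>R\<^esub> coeff P g j" unfolding j_def using ex(2) by (rule LeastI_ex)
  have less_j: "p divides\<^bsub>R\<^esub> coeff P g k" if "k < j" for k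
    using not_less_Least[OF that[unfolded j_def]] by (rule notnotD)
  let ?t = "\<lambda>k. coeff P f k \<otimes> coeff P g (i + j - k)"
  have t: "?t k \<in> carrier R" for k using f g by simp
  have "p divides\<^bsub>R\<^esub> coeff P (f \<otimes>\<^bsub>P\<^esub> g) (i + j)"
    using iffD1[OF const_divides_iff[OF p(1) UP_mult_closed[OF f g]] dvd] ..
  also have "coeff P (f \<otimes>\<^bsub>P\<^esub> g) (i + j) = (\<Oplus>k\<in>insert i ({..i+j} - {i}). ?t k)"
    using f g by (simp add: insert_absorb)
  also have "\<dots> = ?t i \<oplus> (\<Oplus>k\<in>{..i+j} - {i}. ?t k)"
    using f g by (intro R.finsum_insert) auto
  finally have 1: "p divides\<^bsub>R\<^esub> (?t i \<oplus> (\<Oplus>k\<in>{..i+j} - {i}. ?t k))" .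
  have 2: "p divides\<^bsub>R\<^esub> (\<Oplus>k\<in>{..i+j} - {i}. ?t k)"
  proof (rule R.divides_finsum[OF p(1)])
    fix k assume k: "k \<in> {..i+j} - {i}"
    have "p divides\<^bsub>R\<^esub> ?t k"
    proof (cases "k < i")
      case True
      then show ?thesis using less_i p f g by (intro R.divides_mult_right) auto
    next
      case False
      then have "i + j - k < j" using k by auto
      then show ?thesis using less_j p f g by (intro R.divides_mult_left) auto
    qed
    then show "?t k \<in> carrier R \<and> p divides\<^bsub>R\<^esub> ?t k" using t by simp
  qed
  have "p divides\<^bsub>R\<^esub> ?t i"
    by (rule R.divides_add_cancel[OF 1 2 p(1)]) (use f g in \<open>auto intro!: R.finsum_closed\<close>)
  then have "p divides\<^bsub>R\<^esub> (coeff P f i \<otimes> coeff P g j)" by simp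
  moreover have "Divisibility.prime R p" using p(2) by (simp add: ring_prime_def)
  ultimately have "p divides\<^bsub>R\<^esub> coeff P f i \<or> p divides\<^bsub>R\<^esub> coeff P g j"
    using f g unfolding Divisibility.prime_def by simp
  then show False using i j by simp
qed

text \<open>Gauss's primitivity without contents or gcds: constants are split off one irreducible at
  a time. If \<open>R\<close> has no irreducibles, as for a field, every polynomial is
  primitive.\<close>

definition primitive where
  "primitive f \<longleftrightarrow> (\<forall>\<pi>\<in>carrier R. ring_irreducible\<^bsub>R\<^esub> \<pi> \<longrightarrow> \<not> const \<pi> divides\<^bsub>P\<^esub> f)"

lemma const_mult: "\<lbrakk>a \<in> carrier R; b \<in> carrier R\<rbrakk> \<Longrightarrow> const (a \<otimes> b) = const a \<otimes>\<^bsub>P\<^esub> const b"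
  using monom_mult[of a b 0 0] by simp

lemma const_eq_zero_iff: "a \<in> carrier R \<Longrightarrow> const a = \<zero>\<^bsub>P\<^esub> \<longleftrightarrow> a = \<zero>"
  by (metis coeff_monom coeff_zero monom_zero)

text \<open>The irreducible factors of \<open>a\<close> are cancelled one by one: such a factor
  divides \<open>f q\<close> but not the primitive \<open>f\<close>, so by Gauss's lemma it divides
  \<open>q\<close>. This stands in for passing to the fraction field.\<close>

lemma primitive_divides_cancel:
  assumes f: "f \<in> carrier P" "primitive f" and "a \<in> carrier R" "a \<noteq> \<zero>"
    and h: "h \<in> carrier P" and "f divides\<^bsub>P\<^esub> (const a \<otimes>\<^bsub>P\<^esub> h)"
  shows "f divides\<^bsub>P\<^esub> h"
  using assms(3,4,6)
proof (induction "\<delta> a" arbitrary: a rule: less_induct)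
  case less
  note a = less.prems(1,2)
  obtain q where q: "q \<in> carrier P" "const a \<otimes>\<^bsub>P\<^esub> h = f \<otimes>\<^bsub>P\<^esub> q"
    using less.prems unfolding factor_def by auto
  show ?case
  proof (cases "a \<in> Units R")
    case True
    then have inv: "inv\<^bsub>R\<^esub> a \<in> carrier R" by simp
    have "const (inv\<^bsub>R\<^esub> a) \<otimes>\<^bsub>P\<^esub> (const a \<otimes>\<^bsub>P\<^esub> h) = const (inv\<^bsub>R\<^esub> a \<otimes> a) \<otimes>\<^bsub>P\<^esub> h"
      using a inv h by (simp add: const_mult P.m_assoc)
    also have "\<dots> = h" using True h by simp
    finally show ?thesis
      using less.prems(3) P.divides_mult_left[of f "const a \<otimes>\<^bsub>P\<^esub> h" "const (inv\<^bsub>R\<^esub> a)"] f h a inv by simp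
  next
    case False
    obtain \<pi> b where pb: "\<pi> \<in> carrier R" "ring_irreducible\<^bsub>R\<^esub> \<pi>" "b \<in> carrier R" "a = \<pi> \<otimes> b"
      using irreducible_factor_exists[OF a False] .
    have nz: "\<pi> \<noteq> \<zero>" "b \<noteq> \<zero>" using pb a by auto
    have "\<delta> \<pi> \<noteq> 0"
      using degree_0_imp_Unit[of \<pi>] nz pb R.ring_irreducibleE(4) by blast
    then have less_b: "\<delta> b < \<delta> a" using pb nz by (simp add: degree_mult)
    have eq1: "const \<pi> \<otimes>\<^bsub>P\<^esub> (const b \<otimes>\<^bsub>P\<^esub> h) = f \<otimes>\<^bsub>P\<^esub> q"
      using q pb h by (simp add: const_mult P.m_assoc)
    then have "const \<pi> divides\<^bsub>P\<^esub> (f \<otimes>\<^bsub>P\<^esub> q)"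
      using pb h by (intro dividesI[of "const b \<otimes>\<^bsub>P\<^esub> h"]) auto
    then have "const \<pi> divides\<^bsub>P\<^esub> q"
      using const_prime[OF pb(1) irreducible_imp_prime[OF pb(1,2)] f(1) q(1)] f(2) pb
      by (auto simp: primitive_def)
    then obtain r where r: "r \<in> carrier P" "q = const \<pi> \<otimes>\<^bsub>P\<^esub> r" unfolding factor_def by auto
    have "const \<pi> \<otimes>\<^bsub>P\<^esub> (const b \<otimes>\<^bsub>P\<^esub> h) = const \<pi> \<otimes>\<^bsub>P\<^esub> (f \<otimes>\<^bsub>P\<^esub> r)"
      unfolding eq1 r(2) using r(1) f pb by (simp add: P.m_lcomm)
    then have "const b \<otimes>\<^bsub>P\<^esub> h = f \<otimes>\<^bsub>P\<^esub> r"
      using domain.m_lcancel[OF domain_P, of "const \<pi>" "const b \<otimes>\<^bsub>P\<^esub> h" "f \<otimes>\<^bsub>P\<^esub> r"] pb h f r nz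
      by (simp add: const_eq_zero_iff)
    then have "f divides\<^bsub>P\<^esub> (const b \<otimes>\<^bsub>P\<^esub> h)" using r by (auto intro: dividesI)
    then show ?thesis using less.hyps[OF less_b pb(3) nz(2)] by simp
  qed
qed

lemma primitive_part_exists:
  assumes "w \<in> carrier P" "w \<noteq> \<zero>\<^bsub>P\<^esub>"
  obtains c w' where "c \<in> carrier R" "c \<noteq> \<zero>" "w' \<in> carrier P" "w = const c \<otimes>\<^bsub>P\<^esub> w'" "primitive w'"
proof -
  have "\<exists>c w'. c \<in> carrier R \<and> c \<noteq> \<zero> \<and> w' \<in> carrier P \<and> w = const c \<otimes>\<^bsub>P\<^esub> w' \<and> primitive w'"
    using assms
  \<comment> \<open>Dividing by an irreducible constant keeps \<open>deg R w\<close> and lowers the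
    degree of the leading coefficient, so splitting off constants terminates.\<close>
  proof (induction "\<delta> (coeff P w (deg R w))" arbitrary: w rule: less_induct)
    case less
    show ?case
    proof (cases "primitive w")
      case True
      then show ?thesis using less.prems
        by (intro exI[of _ \<one>] exI[of _ w]) auto
    next
      case False
      then obtain \<pi> v where v: "\<pi> \<in> carrier R" "ring_irreducible\<^bsub>R\<^esub> \<pi>" "v \<in> carrier P" "w = const \<pi> \<otimes>\<^bsub>P\<^esub> v"
        unfolding primitive_def factor_def by blast
      have nz: "\<pi> \<noteq> \<zero>" "v \<noteq> \<zero>\<^bsub>P\<^esub>" using v less.prems by auto
      have w: "w = \<pi> \<odot>\<^bsub>P\<^esub> v" using v by (simp add: smult_conv_const)
      have "deg R w = deg R v" unfolding w using v(1,3) nz by simp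
      moreover have "coeff P w (deg R w) = \<pi> \<otimes> coeff P v (deg R w)"
        unfolding w using v(1,3) by (rule coeff_smult)
      moreover have "\<delta> \<pi> \<noteq> 0"
        using degree_0_imp_Unit[of \<pi>] nz v R.ring_irreducibleE(4) by blast
      ultimately have "\<delta> (coeff P v (deg R v)) < \<delta> (coeff P w (deg R w))"
        using v nz lcoeff_nonzero[OF nz(2) v(3)] by (simp add: degree_mult)
      then obtain c w' where cw: "c \<in> carrier R" "c \<noteq> \<zero>" "w' \<in> carrier P" "v = const c \<otimes>\<^bsub>P\<^esub> w'" "primitive w'"
        using less.hyps[of v] v nz by blast
      then show ?thesis using v nz
        by (intro exI[of _ "\<pi> \<otimes> c"] exI[of _ w']) (auto simp: const_mult P.m_assoc R.integral_iff)
    qed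
  qed
  then show ?thesis using that by blast
qed

text \<open>For \<open>f\<close> primitive, the ideal of all \<open>s\<close> with \<open>f\<close> dividing \<open>s h\<close> contains \<open>f\<close> and \<open>g\<close>. By
  pseudo-division, the primitive part \<open>w'\<close> of an element of least degree in it divides both of them,
  and then irreducibility of \<open>f\<close> decides which of \<open>g\<close> and \<open>h\<close> is divisible by \<open>f\<close>.\<close>

theorem UP_irreducible_imp_prime:
  assumes f: "f \<in> carrier P" and irr: "ring_irreducible\<^bsub>P\<^esub> f"
  shows "ring_prime\<^bsub>P\<^esub> f"
proof -
  note fE = domain.ring_irreducibleE[OF domain_P f irr]
  have "f divides\<^bsub>P\<^esub> g \<or> f divides\<^bsub>P\<^esub> h"
    if g: "g \<in> carrier P" and h: "h \<in> carrier P" and dvd: "f divides\<^bsub>P\<^esub> (g \<otimes>\<^bsub>P\<^esub> h)" for g h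
  \<comment> \<open>An irreducible \<open>f\<close> that is not primitive is associated to an
    irreducible constant, for which \<open>const_prime\<close> decides. Only a primitive
    \<open>f\<close> needs the ideal.\<close>
  proof (cases "primitive f")
    case False
    then obtain \<pi> q where q: "\<pi> \<in> carrier R" "ring_irreducible\<^bsub>R\<^esub> \<pi>" "q \<in> carrier P" "f = const \<pi> \<otimes>\<^bsub>P\<^esub> q"
      unfolding primitive_def factor_def by blast
    have "const \<pi> \<notin> Units P"
    proof
      assume "const \<pi> \<in> Units P"
      then obtain v where v: "v \<in> carrier P" "const \<pi> \<otimes>\<^bsub>P\<^esub> v = \<one>\<^bsub>P\<^esub>"
        using P.Units_r_inv_ex by blast
      then have "coeff P (\<pi> \<odot>\<^bsub>P\<^esub> v) 0 = coeff P \<one>\<^bsub>P\<^esub> 0" using q by (simp add: smult_conv_const)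
      then have "\<one> = \<pi> \<otimes> coeff P v 0" using q v by simp
      then have "\<pi> divides\<^bsub>R\<^esub> \<one>" using v by (intro dividesI) auto
      then show False using q R.divides_one R.ring_irreducibleE(4) by blast
    qed
    then have u: "q \<in> Units P" using fE(5)[of "const \<pi>" q] q by auto
    have "const \<pi> = f \<otimes>\<^bsub>P\<^esub> inv\<^bsub>P\<^esub> q"
      using u q by (simp add: P.m_assoc)
    then have f_dvd: "f divides\<^bsub>P\<^esub> const \<pi>" using u by (intro dividesI) auto
    have "const \<pi> divides\<^bsub>P\<^esub> f" using q by (intro dividesI)
    then have "const \<pi> divides\<^bsub>P\<^esub> (g \<otimes>\<^bsub>P\<^esub> h)"
      using P.divides_trans[OF _ dvd, of "const \<pi>"] q by simp
    then have "const \<pi> divides\<^bsub>P\<^esub> g \<or> const \<pi> divides\<^bsub>P\<^esub> h"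
      using const_prime[OF q(1) irreducible_imp_prime[OF q(1,2)] g h] by simp
    then show ?thesis using P.divides_trans[OF f_dvd] f by blast
  next
    case True
    define J where "J = {s \<in> carrier P. s \<noteq> \<zero>\<^bsub>P\<^esub> \<and> f divides\<^bsub>P\<^esub> (s \<otimes>\<^bsub>P\<^esub> h)}"
    have fJ: "f \<in> J" using f fE(1) h by (auto simp: J_def)
    define w where "w = arg_min (deg R) (\<lambda>s. s \<in> J)"
    have wJ: "w \<in> J" and w_min: "\<And>s. s \<in> J \<Longrightarrow> deg R w \<le> deg R s"
      unfolding w_def using arg_min_nat_lemma[of "\<lambda>s. s \<in> J" f "deg R"] fJ by auto
    have w: "w \<in> carrier P" "w \<noteq> \<zero>\<^bsub>P\<^esub>" "f divides\<^bsub>P\<^esub> (w \<otimes>\<^bsub>P\<^esub> h)" using wJ by (auto simp: J_def)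
    obtain c w' where cw: "c \<in> carrier R" "c \<noteq> \<zero>" "w' \<in> carrier P" "w = const c \<otimes>\<^bsub>P\<^esub> w'" "primitive w'"
      using primitive_part_exists[OF w(1,2)] .
    have w'_dvd: "w' divides\<^bsub>P\<^esub> s" if s: "s \<in> carrier P" "f divides\<^bsub>P\<^esub> (s \<otimes>\<^bsub>P\<^esub> h)" for s
    proof -
      \<comment> \<open>Pseudo-division by \<open>w\<close> scales \<open>s\<close> by a power
        \<open>a\<close> of the leading coefficient of \<open>w\<close>. The primitivity of
        \<open>w'\<close> removes this factor again at the end.\<close>
      obtain q r and k :: nat where qr: "q \<in> carrier P" "r \<in> carrier P"
        "(coeff P w (deg R w))[^]\<^bsub>R\<^esub>k \<odot>\<^bsub>P\<^esub> s = w \<otimes>\<^bsub>P\<^esub> q \<oplus>\<^bsub>P\<^esub> r" "r = \<zero>\<^bsub>P\<^esub> \<or> deg R r < deg R w"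
        using long_div_theorem[OF w(1) s(1) w(2)] by blast
      define a where "a = (coeff P w (deg R w))[^]\<^bsub>R\<^esub>k"
      have a: "a \<in> carrier R" unfolding a_def using w by simp
      have a_nz: "a \<noteq> \<zero>"
        unfolding a_def using w lcoeff_nonzero[OF w(2,1)] by (induction k) (auto simp: R.integral_iff)
      have eq: "w \<otimes>\<^bsub>P\<^esub> q \<oplus>\<^bsub>P\<^esub> r = const a \<otimes>\<^bsub>P\<^esub> s"
        using qr(3) a s by (simp add: a_def smult_conv_const)
      have "r \<otimes>\<^bsub>P\<^esub> h \<oplus>\<^bsub>P\<^esub> q \<otimes>\<^bsub>P\<^esub> (w \<otimes>\<^bsub>P\<^esub> h) = (w \<otimes>\<^bsub>P\<^esub> q \<oplus>\<^bsub>P\<^esub> r) \<otimes>\<^bsub>P\<^esub> h"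
        using qr(1,2) w(1) h by (simp add: P.l_distr P.r_distr P.m_ac P.a_comm)
      also have "\<dots> = const a \<otimes>\<^bsub>P\<^esub> (s \<otimes>\<^bsub>P\<^esub> h)" using eq a s h by (simp add: P.m_assoc)
      finally have "f divides\<^bsub>P\<^esub> (r \<otimes>\<^bsub>P\<^esub> h \<oplus>\<^bsub>P\<^esub> q \<otimes>\<^bsub>P\<^esub> (w \<otimes>\<^bsub>P\<^esub> h))"
        using P.divides_mult_left[OF s(2) f] a s h by simp
      then have "f divides\<^bsub>P\<^esub> (r \<otimes>\<^bsub>P\<^esub> h)"
        by (rule P.divides_add_cancel[OF _ P.divides_mult_left[OF w(3) f]]) (use qr w h f in auto)
      then have "r = \<zero>\<^bsub>P\<^esub>" using qr(2,4) w_min[of r] unfolding J_def by force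
      then have "const a \<otimes>\<^bsub>P\<^esub> s = w' \<otimes>\<^bsub>P\<^esub> (const c \<otimes>\<^bsub>P\<^esub> q)"
        using eq[symmetric] qr w cw by (simp add: P.m_ac)
      then have "w' divides\<^bsub>P\<^esub> (const a \<otimes>\<^bsub>P\<^esub> s)" using cw qr by (intro dividesI[of "const c \<otimes>\<^bsub>P\<^esub> q"]) auto
      then show ?thesis using primitive_divides_cancel[OF cw(3,5) a a_nz s(1)] by simp
    qed
    have "w' divides\<^bsub>P\<^esub> f" using w'_dvd[of f] fJ by (auto simp: J_def)
    then obtain t where t: "t \<in> carrier P" "f = w' \<otimes>\<^bsub>P\<^esub> t" unfolding factor_def by auto
    \<comment> \<open>If \<open>w'\<close> is a unit, then \<open>f\<close> divides a nonzero
      constant times \<open>h\<close>, hence \<open>h\<close>. If \<open>t\<close> is a unit,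
      \<open>f\<close> is associated to \<open>w'\<close>, which divides \<open>g\<close> because
      \<open>g\<close> satisfies the condition of the ideal.\<close>
    then consider "w' \<in> Units P" | "t \<in> Units P" using fE(5)[OF cw(3) t(1)] by auto
    then show ?thesis
    proof cases
      case 1
      have "f divides\<^bsub>P\<^esub> (const c \<otimes>\<^bsub>P\<^esub> (w' \<otimes>\<^bsub>P\<^esub> h))" using w(3) cw h by (simp add: P.m_assoc)
      then have "f divides\<^bsub>P\<^esub> (w' \<otimes>\<^bsub>P\<^esub> h)"
        by (rule primitive_divides_cancel[OF f True cw(1,2) UP_mult_closed[OF cw(3) h]])
      then have "f divides\<^bsub>P\<^esub> (inv\<^bsub>P\<^esub> w' \<otimes>\<^bsub>P\<^esub> (w' \<otimes>\<^bsub>P\<^esub> h))"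
        by (rule P.divides_mult_left) (use 1 f cw(3) h in simp_all)
      also have "inv\<^bsub>P\<^esub> w' \<otimes>\<^bsub>P\<^esub> (w' \<otimes>\<^bsub>P\<^esub> h) = h"
        using 1 cw(3) h P.m_assoc[of "inv\<^bsub>P\<^esub> w'" w' h] by simp
      finally show ?thesis ..
    next
      case 2
      have "w' = f \<otimes>\<^bsub>P\<^esub> inv\<^bsub>P\<^esub> t" using 2 t cw(3) by (simp add: P.m_assoc)
      then have "f divides\<^bsub>P\<^esub> w'" using 2 by (intro dividesI) auto
      then show ?thesis using P.divides_trans[OF _ w'_dvd[OF g dvd]] f by blast
    qed
  qed
  then have "Divisibility.prime P f" using fE(4) by (intro Divisibility.primeI) auto
  then show ?thesis using fE(1) by (simp add: ring_prime_def)
qed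

end

lemma ring_iso_irreducible_imp_prime:
  assumes R: "domain R" and S: "domain S" and h: "h \<in> ring_iso R S"
    and R_prime: "\<And>a. \<lbrakk>a \<in> carrier R; ring_irreducible\<^bsub>R\<^esub> a\<rbrakk> \<Longrightarrow> ring_prime\<^bsub>R\<^esub> a"
    and b: "b \<in> carrier S" "ring_irreducible\<^bsub>S\<^esub> b"
  shows "ring_prime\<^bsub>S\<^esub> b"
proof -
  interpret R: domain R by (rule R)
  interpret S: domain S by (rule S)
  note hE = ring_iso_memE[OF h]
  define g where "g = inv_into (carrier R) h"
  have g: "g \<in> ring_iso S R" unfolding g_def using ring_iso_set_sym[OF R.ring_axioms h] .
  note gE = ring_iso_memE[OF g]
  have hg: "h (g x) = x" if "x \<in> carrier S" for x
    using that hE(5) by (auto simp: g_def bij_betw_def f_inv_into_f)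
  have gh: "g (h x) = x" if "x \<in> carrier R" for x
    using that hE(5) by (auto simp: g_def bij_betw_def)
  have dvd: "x divides\<^bsub>S\<^esub> y" if "g x divides\<^bsub>R\<^esub> g y" "x \<in> carrier S" "y \<in> carrier S" for x y
  proof -
    obtain z where "z \<in> carrier R" "g y = g x \<otimes>\<^bsub>R\<^esub> z" using \<open>g x divides\<^bsub>R\<^esub> g y\<close> unfolding factor_def by auto
    then have "y = x \<otimes>\<^bsub>S\<^esub> h z" by (metis hE(2) hg gE(1) that(2,3))
    then show ?thesis using hE(1) \<open>z \<in> carrier R\<close> by (auto intro: dividesI)
  qed
  have dvd': "g x divides\<^bsub>R\<^esub> g y" if "x divides\<^bsub>S\<^esub> y" "x \<in> carrier S" "y \<in> carrier S" for x y
    using that gE(1,2) unfolding factor_def by (metis)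
  have units: "x \<in> Units S \<longleftrightarrow> g x \<in> Units R" if "x \<in> carrier S" for x
    using dvd[of x "\<one>\<^bsub>S\<^esub>"] dvd'[of x "\<one>\<^bsub>S\<^esub>"] gE(1,4) that S.divides_one R.divides_one by (metis S.one_closed)
  have "g \<in> ring_hom S R" using g by (simp add: ring_iso_def)
  then have g0: "g \<zero>\<^bsub>S\<^esub> = \<zero>\<^bsub>R\<^esub>"
    using ring_hom_zero S.ring_axioms R.ring_axioms by blast
  note bE = S.ring_irreducibleE[OF b]
  have "ring_irreducible\<^bsub>R\<^esub> (g b)"
  proof (rule R.ring_irreducibleI)
    have "g b \<noteq> \<zero>\<^bsub>R\<^esub>" using bE(1) b(1) g0 hg by (metis S.zero_closed)
    then show "g b \<in> carrier R - {\<zero>\<^bsub>R\<^esub>}" using gE(1) b by simp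
    show "g b \<notin> Units R" using units b bE(4) by simp
    fix x y assume xy: "x \<in> carrier R" "y \<in> carrier R" "g b = x \<otimes>\<^bsub>R\<^esub> y"
    then have "b = h x \<otimes>\<^bsub>S\<^esub> h y" using hE(2) hg b by metis
    then have "h x \<in> Units S \<or> h y \<in> Units S" using bE(5) hE(1) xy by blast
    then show "x \<in> Units R \<or> y \<in> Units R" using units hE(1) xy gh by metis
  qed
  then have "ring_prime\<^bsub>R\<^esub> (g b)" using R_prime gE(1) b by simp
  then have pr: "Divisibility.prime R (g b)" by (simp add: ring_prime_def)
  have "Divisibility.prime S b"
  proof (rule Divisibility.primeI)
    show "b \<notin> Units S" by (rule bE(4))
    fix x y assume xy: "x \<in> carrier S" "y \<in> carrier S" "b divides\<^bsub>S\<^esub> (x \<otimes>\<^bsub>S\<^esub> y)"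
    then have "g b divides\<^bsub>R\<^esub> (g x \<otimes>\<^bsub>R\<^esub> g y)" using dvd'[OF xy(3) b(1)] gE(2) by simp
    then have "g b divides\<^bsub>R\<^esub> g x \<or> g b divides\<^bsub>R\<^esub> g y"
      using pr gE(1) xy unfolding Divisibility.prime_def by simp
    then show "b divides\<^bsub>S\<^esub> x \<or> b divides\<^bsub>S\<^esub> y" using dvd b xy by blast
  qed
  then show ?thesis using bE(1) by (simp add: ring_prime_def)
qed

lemma (in field) mpoly_degree_domain: "degree_domain (mpoly_ring n R) (total_degree R)"
proof -
  interpret M: domain "mpoly_ring n R" by (rule mpoly_domain)
  show ?thesis
  proof
    fix f assume "f \<in> carrier (mpoly_ring n R)" "f \<noteq> \<zero>\<^bsub>mpoly_ring n R\<^esub>" "total_degree R f = 0"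
    then show "f \<in> Units (mpoly_ring n R)"
      by (rule total_degree_0_imp_const) (auto intro: mpoly_const_Unit)
  qed (rule total_degree_mult)
qed

text \<open>Induction on the number of variables. With none, every nonzero polynomial has degree 0
  and is a unit, so there are no irreducibles to consider.\<close>

theorem (in field) mpoly_degree_ufd: "degree_ufd (mpoly_ring n R) (total_degree R)"
proof (induction n)
  case 0
  interpret M: degree_domain "mpoly_ring 0 R" "total_degree R" by (rule mpoly_degree_domain)
  show ?case
  proof
    fix f assume f: "f \<in> carrier (mpoly_ring 0 R)" "ring_irreducible\<^bsub>mpoly_ring 0 R\<^esub> f"
    have "f \<noteq> \<zero>\<^bsub>mpoly_ring 0 R\<^esub>" using M.ring_irreducibleE(1)[OF f] .
    then obtain m where "f m \<noteq> \<zero>" "size m = total_degree R f" using total_degree_attained[OF f(1)] by blast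
    then have "total_degree R f = 0" using f(1) by (auto simp: mpoly_ring_sel)
    then have "f \<in> Units (mpoly_ring 0 R)" using M.degree_0_imp_Unit f(1) \<open>f \<noteq> _\<close> by blast
    then show "ring_prime\<^bsub>mpoly_ring 0 R\<^esub> f" using M.ring_irreducibleE(4)[OF f] by simp
  qed
next
  case (Suc n)
  interpret D: degree_ufd "mpoly_ring n R" "total_degree R" by (rule Suc)
  interpret P: UP_degree_ufd "mpoly_ring n R" "UP (mpoly_ring n R)" "total_degree R"
    by unfold_locales auto
  interpret M: degree_domain "mpoly_ring (Suc n) R" "total_degree R" by (rule mpoly_degree_domain)
  show ?case
  proof
    fix f assume f: "f \<in> carrier (mpoly_ring (Suc n) R)" "ring_irreducible\<^bsub>mpoly_ring (Suc n) R\<^esub> f"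
    show "ring_prime\<^bsub>mpoly_ring (Suc n) R\<^esub> f"
      using ring_iso_irreducible_imp_prime[OF P.domain_P M.domain_axioms
          mpoly_of_UP_iso[OF D.ring_axioms] P.UP_irreducible_imp_prime f] .
  qed
qed

section \<open>Counting primes of given degree\<close>

locale finite_degree_ufd = degree_ufd R \<delta> for R (structure) and \<delta> +
  assumes finite_degree: "finite {a \<in> carrier R. a \<noteq> \<zero> \<and> \<delta> a = d}"
begin

definition level where "level d = {a \<in> carrier R. a \<noteq> \<zero> \<and> \<delta> a = d}"

definition assoc_class where "assoc_class a = (\<lambda>u. u \<otimes> a) ` Units R"

definition prime_classes where
  "prime_classes = assoc_class ` {a \<in> carrier R. ring_irreducible a}"

text \<open>An arbitrary representative replaces a normal form by leading coefficients; its degree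
  and the elements divisible by it depend only on the class.\<close>

definition rep where
  "rep C = (SOME a. a \<in> carrier R \<and> ring_irreducible a \<and> assoc_class a = C)"

lemma rep:
  assumes "C \<in> prime_classes"
  shows "rep C \<in> carrier R" "ring_irreducible (rep C)" "assoc_class (rep C) = C"
proof -
  have "\<exists>a. a \<in> carrier R \<and> ring_irreducible a \<and> assoc_class a = C"
    using assms by (auto simp: prime_classes_def)
  then have "rep C \<in> carrier R \<and> ring_irreducible (rep C) \<and> assoc_class (rep C) = C"
    unfolding rep_def by (rule someI_ex)
  then show "rep C \<in> carrier R" "ring_irreducible (rep C)" "assoc_class (rep C) = C" by auto
qed

lemma assoc_class_self: "a \<in> carrier R \<Longrightarrow> a \<in> assoc_class a"
  unfolding assoc_class_def by (rule image_eqI[of _ _ \<one>]) auto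

lemma assoc_class_eqI:
  assumes a: "a \<in> carrier R" and u: "u \<in> Units R"
  shows "assoc_class (u \<otimes> a) = assoc_class a"
proof (intro equalityI subsetI)
  fix x assume "x \<in> assoc_class (u \<otimes> a)"
  then obtain v where "v \<in> Units R" "x = v \<otimes> (u \<otimes> a)" by (auto simp: assoc_class_def)
  then have "v \<otimes> u \<in> Units R" "x = (v \<otimes> u) \<otimes> a"
    using u a by (auto simp: m_assoc Units_closed)
  then show "x \<in> assoc_class a" by (auto simp: assoc_class_def)
next
  fix x assume "x \<in> assoc_class a"
  then obtain v where v: "v \<in> Units R" "x = v \<otimes> a" by (auto simp: assoc_class_def)
  have "(v \<otimes> inv u) \<otimes> (u \<otimes> a) = v \<otimes> ((inv u \<otimes> u) \<otimes> a)"
    using u v a by (simp add: m_assoc Units_closed del: Units_l_inv)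
  then have "x = (v \<otimes> inv u) \<otimes> (u \<otimes> a)" using u v a by simp
  moreover have "v \<otimes> inv u \<in> Units R" using u v by auto
  ultimately show "x \<in> assoc_class (u \<otimes> a)" by (auto simp: assoc_class_def)
qed

lemma degree_assoc_class:
  assumes "assoc_class a = assoc_class b" "a \<in> carrier R" "b \<in> carrier R" "a \<noteq> \<zero>" 
  shows "\<delta> a = \<delta> b"
proof -
  obtain u where "u \<in> Units R" "b = u \<otimes> a"
    using assms assoc_class_self[of b] by (auto simp: assoc_class_def)
  then show ?thesis using assms by (simp add: degree_mult degree_Unit Unit_nonzero Units_closed)
qed

text \<open>Matches the form of \<open>monic_irreducibles\<close>, an image of irreducibles of given
  degree, with degrees of chosen representatives; associates have equal degree.\<close>

lemma prime_classes_degree: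
  "assoc_class ` {a \<in> carrier R. ring_irreducible a \<and> \<delta> a = j} = {C \<in> prime_classes. \<delta> (rep C) = j}"
proof (intro equalityI subsetI)
  fix C assume "C \<in> assoc_class ` {a \<in> carrier R. ring_irreducible a \<and> \<delta> a = j}"
  then obtain a where a: "a \<in> carrier R" "ring_irreducible a" "\<delta> a = j" "C = assoc_class a" by auto
  then have C: "C \<in> prime_classes" by (auto simp: prime_classes_def)
  have "\<delta> a = \<delta> (rep C)"
    using a rep[OF C] ring_irreducibleE(1)[OF a(1,2)] by (intro degree_assoc_class) auto
  then show "C \<in> {C \<in> prime_classes. \<delta> (rep C) = j}" using C a by auto
next
  fix C assume "C \<in> {C \<in> prime_classes. \<delta> (rep C) = j}"
  then show "C \<in> assoc_class ` {a \<in> carrier R. ring_irreducible a \<and> \<delta> a = j}"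
    using rep[of C] by (intro image_eqI[of _ _ "rep C"]) auto
qed

lemma degree_irreducible_pos:
  assumes "a \<in> carrier R" "ring_irreducible a"
  shows "\<delta> a > 0"
  using degree_0_imp_Unit[of a] ring_irreducibleE(1,4)[OF assms] assms by auto

lemma finite_prime_classes: "finite {C \<in> prime_classes. \<delta> (rep C) = j}"
  unfolding prime_classes_degree[symmetric]
proof (intro finite_imageI, rule finite_subset[OF _ finite_degree[of j]])
  show "{a \<in> carrier R. ring_irreducible a \<and> \<delta> a = j} \<subseteq> {a \<in> carrier R. a \<noteq> \<zero> \<and> \<delta> a = j}"
    by (auto simp: ring_irreducible_def)
qed

lemma pow_nonzero: "a \<in> carrier R \<Longrightarrow> a \<noteq> \<zero> \<Longrightarrow> a [^] (e::nat) \<noteq> \<zero>"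
  by (induction e) (auto simp: integral_iff)

lemma degree_pow: "a \<in> carrier R \<Longrightarrow> a \<noteq> \<zero> \<Longrightarrow> \<delta> (a [^] (e::nat)) = e * \<delta> a"
  by (induction e) (auto simp: degree_mult degree_one pow_nonzero)

lemma degree_divides:
  assumes "a divides b" "a \<in> carrier R" "b \<in> carrier R" "b \<noteq> \<zero>"
  shows "\<delta> a \<le> \<delta> b"
proof -
  obtain c where c: "c \<in> carrier R" "b = a \<otimes> c" using assms(1) unfolding factor_def by auto
  have "a \<noteq> \<zero>" "c \<noteq> \<zero>" using c assms(2,4) by auto
  then show ?thesis using degree_mult[of a c] c assms(2) by simp
qed

lemma prime_pow_divides_cancel:
  assumes p: "p \<in> carrier R" "ring_irreducible p" and a: "a \<in> carrier R" "\<not> p divides a"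
    and b: "b \<in> carrier R" and "p [^] (e::nat) divides (a \<otimes> b)"
  shows "p [^] e divides b"
  using assms(6)
proof (induction e)
  case 0
  then show ?case using b by (simp add: one_divides)
next
  case (Suc e)
  then obtain k where k: "k \<in> carrier R" "a \<otimes> b = p [^] Suc e \<otimes> k" unfolding factor_def by auto
  have "a \<otimes> b = p [^] e \<otimes> (p \<otimes> k)" using k p by (simp add: m_assoc)
  then have "p [^] e divides (a \<otimes> b)" using k p by (intro dividesI[of "p \<otimes> k"]) auto
  then obtain c where c: "c \<in> carrier R" "b = p [^] e \<otimes> c" using Suc.IH unfolding factor_def by auto
  have "p [^] e \<otimes> (a \<otimes> c) = a \<otimes> b" using c p a by (simp add: m_lcomm)
  also have "\<dots> = p [^] e \<otimes> (p \<otimes> k)" using k p by (simp add: m_assoc)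
  finally have "a \<otimes> c = p \<otimes> k"
    using m_lcancel[of "p [^] e" "a \<otimes> c" "p \<otimes> k"] pow_nonzero ring_irreducibleE(1)[OF p] p a c k by auto
  then have "p divides (a \<otimes> c)" using k by (intro dividesI[of k])
  then have "p divides c"
    using irreducible_imp_prime[OF p] a c unfolding ring_prime_def Divisibility.prime_def by blast
  then obtain l where "l \<in> carrier R" "c = p \<otimes> l" unfolding factor_def by auto
  then show ?case using c p by (intro dividesI[of l]) (auto simp: m_assoc)
qed

text \<open>For nonzero \<open>a\<close> and a fixed class, the exponents that occur run from 1 to
  the multiplicity of that prime in \<open>a\<close>. The set thus lists the prime factors with
  multiplicity, without a valuation function.\<close>

definition prime_powers_dividing where
  "prime_powers_dividing a = {(C, e :: nat). C \<in> prime_classes \<and> e \<ge> 1 \<and> rep C [^] e divides a}"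

text \<open>A finite range common to all \<open>a\<close> of degree \<open>d\<close>, which permits
  exchanging the two sums of the double count.\<close>

definition prime_powers_upto where
  "prime_powers_upto d = {(C, e :: nat). C \<in> prime_classes \<and> e \<ge> 1 \<and> e * \<delta> (rep C) \<le> d}"

lemma finite_prime_powers_upto: "finite (prime_powers_upto d)"
proof (rule finite_subset)
  show "prime_powers_upto d \<subseteq> (\<Union>j\<le>d. {C \<in> prime_classes. \<delta> (rep C) = j}) \<times> {..d}"
  proof safe
    fix C e assume "(C, e) \<in> prime_powers_upto d"
    then have C: "C \<in> prime_classes" "e \<ge> 1" "e * \<delta> (rep C) \<le> d" by (auto simp: prime_powers_upto_def)
    have "\<delta> (rep C) > 0" using degree_irreducible_pos rep[OF C(1)] by auto
    moreover have "\<delta> (rep C) \<le> e * \<delta> (rep C)" using C(2) by simp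
    moreover have "e \<le> e * \<delta> (rep C)" using \<open>\<delta> (rep C) > 0\<close> by simp
    ultimately have "e \<le> d" "\<delta> (rep C) \<le> d" using C(3) by linarith+
    then show "e \<le> d" "C \<in> (\<Union>j\<le>d. {C \<in> prime_classes. \<delta> (rep C) = j})" using C(1) by auto
  qed
  show "finite ((\<Union>j\<le>d. {C \<in> prime_classes. \<delta> (rep C) = j}) \<times> {..d})"
    using finite_prime_classes by blast
qed

lemma prime_powers_dividing_upto:
  assumes "a \<in> carrier R" "a \<noteq> \<zero>"
  shows "prime_powers_dividing a \<subseteq> prime_powers_upto (\<delta> a)"
proof safe
  fix C e assume "(C, e) \<in> prime_powers_dividing a"
  then have C: "C \<in> prime_classes" "e \<ge> 1" "rep C [^] e divides a" by (auto simp: prime_powers_dividing_def)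
  have "\<delta> (rep C [^] e) \<le> \<delta> a" using C rep[OF C(1)] assms by (intro degree_divides) auto
  then show "(C, e) \<in> prime_powers_upto (\<delta> a)"
    using C rep[OF C(1)] ring_irreducibleE(1) by (auto simp: prime_powers_upto_def degree_pow)
qed

lemma degree_eq_sum_prime_powers:
  assumes "a \<in> carrier R" "a \<noteq> \<zero>"
  shows "\<delta> a = (\<Sum>x\<in>prime_powers_dividing a. \<delta> (rep (fst x)))"
  using assms
proof (induction "\<delta> a" arbitrary: a rule: less_induct)
  case less
  show ?case
  proof (cases "a \<in> Units R")
    case True
    have "prime_powers_upto 0 = {}"
      using rep(1,2) degree_irreducible_pos by (force simp: prime_powers_upto_def)
    then show ?thesis
      using prime_powers_dividing_upto[OF less.prems] degree_Unit[OF True] by auto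
  next
    case False
    obtain \<pi> b where pb: "\<pi> \<in> carrier R" "ring_irreducible \<pi>" "b \<in> carrier R" "a = \<pi> \<otimes> b"
      using irreducible_factor_exists[OF less.prems False] .
    define C\<^sub>0 where "C\<^sub>0 = assoc_class \<pi>"
    define p where "p = rep C\<^sub>0"
    have C0: "C\<^sub>0 \<in> prime_classes" using pb by (auto simp: prime_classes_def C\<^sub>0_def)
    have p: "p \<in> carrier R" "ring_irreducible p" "assoc_class p = C\<^sub>0" using rep[OF C0] by (auto simp: p_def)
    note pE = ring_irreducibleE[OF p(1,2)]
    obtain u where u: "u \<in> Units R" "\<pi> = u \<otimes> p"
      using p(3) assoc_class_self[OF pb(1)] by (auto simp: C\<^sub>0_def assoc_class_def)
    define c where "c = u \<otimes> b"
    have c: "c \<in> carrier R" "a = p \<otimes> c" using u pb p by (auto simp: c_def m_ac)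
    have c_nz: "c \<noteq> \<zero>" using c less.prems p by auto
    have deg_a: "\<delta> a = \<delta> p + \<delta> c" using c c_nz p pE(1) by (simp add: degree_mult)
    have "\<delta> c < \<delta> a" using deg_a degree_irreducible_pos[OF p(1,2)] by simp
    then have IH: "\<delta> c = (\<Sum>x\<in>prime_powers_dividing c. \<delta> (rep (fst x)))"
      using less.hyps c c_nz by blast
    \<comment> \<open>Passing from \<open>c\<close> to \<open>a = p c\<close> raises the
      multiplicity of the class of \<open>p\<close> by one. Moving its exponents up by one leaves
      exactly the pair \<open>(C\<^sub>0, 1)\<close> free, which accounts for the summand
      \<open>\<delta> p\<close>.\<close>
    define shift where "shift x = (if fst x = C\<^sub>0 then (C\<^sub>0, Suc (snd x)) else x)" for x
    have inj: "inj_on shift A" for A by (auto simp: inj_on_def shift_def split: if_splits)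
    have "prime_powers_dividing a = insert (C\<^sub>0, 1) (shift ` prime_powers_dividing c)"
    proof (intro equalityI subsetI)
      fix x assume "x \<in> prime_powers_dividing a"
      then obtain C e where x: "x = (C, e)" "C \<in> prime_classes" "e \<ge> 1" "rep C [^] e divides a"
        by (auto simp: prime_powers_dividing_def)
      show "x \<in> insert (C\<^sub>0, 1) (shift ` prime_powers_dividing c)"
      proof (cases "C = C\<^sub>0")
        case False
        note r = rep[OF x(2)]
        have "\<not> rep C divides p"
        proof
          assume "rep C divides p"
          then obtain k where k: "k \<in> carrier R" "p = rep C \<otimes> k" unfolding factor_def by auto
          then have "k \<in> Units R" using pE(5) r ring_irreducibleE(4) by blast
          then have "assoc_class (k \<otimes> rep C) = assoc_class (rep C)" using r by (intro assoc_class_eqI)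
          then have "assoc_class p = C" using k r by (simp add: m_comm)
          then show False using p False by simp
        qed
        then have "rep C [^] e divides c"
          using prime_pow_divides_cancel[OF r(1,2) p(1) _ c(1)] x(4) c(2) by simp
        then have "(C, e) \<in> prime_powers_dividing c" using x by (simp add: prime_powers_dividing_def)
        then show ?thesis using x False by (auto simp: shift_def intro!: image_eqI[of _ _ "(C, e)"])
      next
        case True
        show ?thesis
        proof (cases "e = 1")
          case False
          then obtain f where f: "e = Suc f" "f \<ge> 1" using x(3) by (cases e) auto
          have "(p \<otimes> p [^] f) divides (p \<otimes> c)" using x(4) True f c p by (simp add: p_def m_comm)
          then have "p [^] f divides c" using mult_divides[of "p [^] f" c p] p c pE(1) by auto
          then have "(C\<^sub>0, f) \<in> prime_powers_dividing c" using f C0 by (simp add: prime_powers_dividing_def p_def)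
          then show ?thesis using x True f by (auto simp: shift_def intro!: image_eqI[of _ _ "(C\<^sub>0, f)"])
        qed (use x True in auto)
      qed
    next
      fix x assume "x \<in> insert (C\<^sub>0, 1) (shift ` prime_powers_dividing c)"
      then consider "x = (C\<^sub>0, 1)" | C e where "(C, e) \<in> prime_powers_dividing c" "x = shift (C, e)" by auto
      then show "x \<in> prime_powers_dividing a"
      proof cases
        case 1
        have "p divides a" using c by (auto intro: dividesI)
        then show ?thesis using 1 C0 p by (simp add: prime_powers_dividing_def p_def)
      next
        case 2
        then have C: "C \<in> prime_classes" "e \<ge> 1" "rep C [^] e divides c" by (auto simp: prime_powers_dividing_def)
        show ?thesis
        proof (cases "C = C\<^sub>0")
          case True
          have "(p \<otimes> p [^] e) divides (p \<otimes> c)" using C True p by (intro divides_mult) (auto simp: p_def)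
          then have "p [^] Suc e divides a" using c p by (simp add: m_comm)
          then show ?thesis using 2 True C0 by (simp add: prime_powers_dividing_def shift_def p_def)
        next
          case False
          have "rep C [^] e divides a" using C rep[OF C(1)] c p divides_mult_left by auto
          then show ?thesis using 2 False C by (simp add: prime_powers_dividing_def shift_def)
        qed
      qed
    qed
    moreover have "(C\<^sub>0, 1) \<notin> shift ` prime_powers_dividing c"
      by (auto simp: shift_def prime_powers_dividing_def split: if_splits)
    moreover have "finite (prime_powers_dividing c)"
      using prime_powers_dividing_upto[OF c(1) c_nz] finite_prime_powers_upto finite_subset by blast
    ultimately have "(\<Sum>x\<in>prime_powers_dividing a. \<delta> (rep (fst x))) =
        \<delta> p + (\<Sum>x\<in>shift ` prime_powers_dividing c. \<delta> (rep (fst x)))"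
      by (simp add: p_def)
    also have "(\<Sum>x\<in>shift ` prime_powers_dividing c. \<delta> (rep (fst x))) =
        (\<Sum>x\<in>prime_powers_dividing c. \<delta> (rep (fst x)))"
      unfolding sum.reindex[OF inj] by (intro sum.cong) (auto simp: shift_def)
    finally show ?thesis using deg_a IH by simp
  qed
qed

lemma card_level_divisible:
  assumes q: "q \<in> carrier R" "q \<noteq> \<zero>" "\<delta> q \<le> d"
  shows "card {a \<in> level d. q divides a} = card (level (d - \<delta> q))"
proof -
  have "bij_betw (\<lambda>b. q \<otimes> b) (level (d - \<delta> q)) {a \<in> level d. q divides a}"
    unfolding bij_betw_def
  proof (intro conjI equalityI subsetI)
    show "inj_on (\<lambda>b. q \<otimes> b) (level (d - \<delta> q))"
      using q by (auto simp: inj_on_def level_def m_lcancel)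
    fix a assume "a \<in> (\<lambda>b. q \<otimes> b) ` level (d - \<delta> q)"
    then show "a \<in> {a \<in> level d. q divides a}"
      using q by (auto simp: level_def degree_mult integral_iff intro: dividesI)
  next
    fix a assume "a \<in> {a \<in> level d. q divides a}"
    then obtain b where b: "b \<in> carrier R" "a = q \<otimes> b" "a \<in> level d" unfolding factor_def by auto
    then have "b \<noteq> \<zero>" using q by (auto simp: level_def)
    then have "b \<in> level (d - \<delta> q)" using b q by (auto simp: level_def degree_mult)
    then show "a \<in> (\<lambda>b. q \<otimes> b) ` level (d - \<delta> q)" using b by auto
  qed
  then show ?thesis by (simp add: bij_betw_same_card)
qed

text \<open>Both sides count, with weight the degree of \<open>P\<close>, the pairs of an element \<open>a\<close> of degree \<open>d\<close>
  and a prime power \<open>P\<^sup>e\<close> with \<open>e \<ge> 1\<close> that divides \<open>a\<close>.\<close>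

theorem degree_times_card_level:
  "d * card (level d) =
     (\<Sum>k=1..d. (\<Sum>j | j dvd k. j * card {C \<in> prime_classes. \<delta> (rep C) = j}) * card (level (d - k)))"
proof -
  let ?cl = "\<lambda>j. {C \<in> prime_classes. \<delta> (rep C) = j}"
  have fin: "finite (level d)" for d using finite_degree by (simp add: level_def)
  note finU = finite_prime_powers_upto[of d]
  have "d * card (level d) = (\<Sum>a\<in>level d. \<delta> a)" by (simp add: level_def)
  also have "\<dots> = (\<Sum>a\<in>level d. \<Sum>x\<in>prime_powers_upto d. if x \<in> prime_powers_dividing a then \<delta> (rep (fst x)) else 0)"
  proof (rule sum.cong[OF refl])
    fix a assume "a \<in> level d"
    then have a: "a \<in> carrier R" "a \<noteq> \<zero>" "\<delta> a = d" by (auto simp: level_def)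
    have "\<delta> a = (\<Sum>x\<in>prime_powers_dividing a. \<delta> (rep (fst x)))"
      using a by (intro degree_eq_sum_prime_powers)
    also have "\<dots> = (\<Sum>x\<in>prime_powers_upto d \<inter> prime_powers_dividing a. \<delta> (rep (fst x)))"
      using prime_powers_dividing_upto[OF a(1,2)] a(3) by (intro sum.cong) auto
    also have "\<dots> = (\<Sum>x\<in>prime_powers_upto d. if x \<in> prime_powers_dividing a then \<delta> (rep (fst x)) else 0)"
      using finU by (rule sum.inter_restrict)
    finally show "\<delta> a = \<dots>" .
  qed
  also have "\<dots> = (\<Sum>x\<in>prime_powers_upto d. \<Sum>a\<in>level d. if x \<in> prime_powers_dividing a then \<delta> (rep (fst x)) else 0)"
    by (rule sum.swap)
  also have "\<dots> = (\<Sum>x\<in>prime_powers_upto d. \<delta> (rep (fst x)) * card (level (d - snd x * \<delta> (rep (fst x)))))"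
  proof (rule sum.cong[OF refl])
    fix x assume x: "x \<in> prime_powers_upto d"
    obtain C e where Ce: "x = (C, e)" by (cases x)
    have C: "C \<in> prime_classes" "e \<ge> 1" "e * \<delta> (rep C) \<le> d" using x by (auto simp: prime_powers_upto_def Ce)
    note r = rep[OF C(1)]
    have nz: "rep C \<noteq> \<zero>" using ring_irreducibleE(1) r by blast
    have "(\<Sum>a\<in>level d. if x \<in> prime_powers_dividing a then \<delta> (rep (fst x)) else 0) =
        \<delta> (rep C) * card {a \<in> level d. x \<in> prime_powers_dividing a}"
      using fin by (simp add: sum.If_cases Ce Int_def)
    also have "{a \<in> level d. x \<in> prime_powers_dividing a} = {a \<in> level d. rep C [^] e divides a}"
      using C by (auto simp: Ce prime_powers_dividing_def)
    also have "card \<dots> = card (level (d - e * \<delta> (rep C)))"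
      using card_level_divisible[of "rep C [^] e" d] r nz C by (simp add: degree_pow pow_nonzero)
    finally show "(\<Sum>a\<in>level d. if x \<in> prime_powers_dividing a then \<delta> (rep (fst x)) else 0) =
        \<delta> (rep (fst x)) * card (level (d - snd x * \<delta> (rep (fst x))))"
      by (simp add: Ce)
  qed
  \<comment> \<open>A prime power is regrouped by its total degree \<open>k\<close> and the degree
    \<open>j\<close> of its prime; the exponent is recovered as \<open>k div j\<close>.\<close>
  also have "\<dots> = (\<Sum>(k, j, C)\<in>Sigma {1..d} (\<lambda>k. Sigma {j. j dvd k} ?cl). j * card (level (d - k)))"
  proof (rule sum.reindex_bij_witness[where
        i = "\<lambda>(k, j, C). (C, k div j)" and j = "\<lambda>(C, e). (e * \<delta> (rep C), \<delta> (rep C), C)"])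
    fix x assume x: "x \<in> prime_powers_upto d"
    obtain C e where Ce: "x = (C, e)" by (cases x)
    have C: "C \<in> prime_classes" "e \<ge> 1" "e * \<delta> (rep C) \<le> d" using x by (auto simp: prime_powers_upto_def Ce)
    have pos: "\<delta> (rep C) > 0" using degree_irreducible_pos rep[OF C(1)] by blast
    show "(case case x of (C, e) \<Rightarrow> (e * \<delta> (rep C), \<delta> (rep C), C) of (k, j, C) \<Rightarrow> (C, k div j)) = x"
      using pos by (simp add: Ce)
    show "(case x of (C, e) \<Rightarrow> (e * \<delta> (rep C), \<delta> (rep C), C)) \<in> Sigma {1..d} (\<lambda>k. Sigma {j. j dvd k} ?cl)"
      using pos C by (simp add: Ce Suc_le_eq)
    show "(case case x of (C, e) \<Rightarrow> (e * \<delta> (rep C), \<delta> (rep C), C) of (k, j, C) \<Rightarrow> j * card (level (d - k))) =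
        \<delta> (rep (fst x)) * card (level (d - snd x * \<delta> (rep (fst x))))"
      by (simp add: Ce)
  next
    fix y assume "y \<in> Sigma {1..d} (\<lambda>k. Sigma {j. j dvd k} ?cl)"
    then obtain k j C where y: "y = (k, j, C)" "1 \<le> k" "k \<le> d" "j dvd k" "C \<in> prime_classes" "\<delta> (rep C) = j"
      by auto
    show "(case case y of (k, j, C) \<Rightarrow> (C, k div j) of (C, e) \<Rightarrow> (e * \<delta> (rep C), \<delta> (rep C), C)) = y"
      using y by simp
    have "k div j \<ge> 1" using y by (auto elim!: dvdE)
    then show "(case y of (k, j, C) \<Rightarrow> (C, k div j)) \<in> prime_powers_upto d"
      using y by (simp add: prime_powers_upto_def)
  qed
  also have "\<dots> = (\<Sum>k=1..d. \<Sum>(j, C)\<in>Sigma {j. j dvd k} ?cl. j * card (level (d - k)))"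
    using finite_prime_classes by (subst sum.Sigma) auto
  also have "\<dots> = (\<Sum>k=1..d. \<Sum>j | j dvd k. \<Sum>C\<in>?cl j. j * card (level (d - k)))"
    using finite_prime_classes by (intro sum.cong refl, subst sum.Sigma) auto
  also have "\<dots> = (\<Sum>k=1..d. (\<Sum>j | j dvd k. j * card (?cl j)) * card (level (d - k)))"
    unfolding sum_distrib_right by (intro sum.cong refl) (simp add: mult_ac)
  finally show ?thesis .
qed

end

section \<open>Values at roots of unity\<close>

unbundle fps_syntax

section \<open>Binomial coefficients modulo a prime\<close>

lemma choose_add_prime_cong:
  fixes p :: nat
  assumes p: "Factorial_Ring.prime p"
  shows "[(p + m) choose r = (m choose r) + (if p \<le> r then m choose (r - p) else 0)] (mod p)"
proof -
  have p2: "p \<ge> 2" using p by (rule prime_ge_2_nat)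
  have "(p + m) choose r = (\<Sum>k\<le>r. (p choose k) * (m choose (r - k)))"
    by (rule vandermonde[symmetric])
  moreover have "[\<dots> = (\<Sum>k\<le>r. if k = 0 \<or> k = p then m choose (r - k) else 0)] (mod p)"
  proof (rule cong_sum)
    fix k assume "k \<in> {..r}"
    consider "k = 0" | "k = p" | "0 < k" "k < p" | "k > p" by linarith
    then show "[(p choose k) * (m choose (r - k)) =
        (if k = 0 \<or> k = p then m choose (r - k) else 0)] (mod p)"
    proof cases
      case 3
      then have "p dvd (p choose k)" using p by (intro dvd_choose_prime) auto
      then show ?thesis using 3 by (simp add: cong_0_iff)
    qed (auto simp: binomial_eq_0)
  qed
  moreover have "(\<Sum>k\<le>r. if k = 0 \<or> k = p then m choose (r - k) else 0) =
      (\<Sum>k\<in>{k. k \<le> r \<and> (k = 0 \<or> k = p)}. m choose (r - k))"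
    by (rule sum.mono_neutral_cong_right) auto
  moreover have "{k. k \<le> r \<and> (k = 0 \<or> k = p)} = (if p \<le> r then {0, p} else {0})" by auto
  ultimately show ?thesis using p2 by (auto split: if_splits)
qed

text \<open>Induction on \<open>a\<close>: adding \<open>p\<close> to the upper index multiplies the
  generating function by \<open>(1 + X) ^ p\<close>, which is \<open>1 + X ^ p\<close> modulo
  \<open>p\<close>. On the leading parts this is Pascal's rule.\<close>

lemma Lucas_step:
  fixes p :: nat
  assumes p: "Factorial_Ring.prime p" and r: "r < p" and s: "s < p"
  shows "[(a * p + r) choose (b * p + s) = (a choose b) * (r choose s)] (mod p)"
proof (induction a arbitrary: b)
  case 0
  show ?case using r by (cases b) (auto simp: binomial_eq_0)
next
  case (Suc a)
  have eq: "Suc a * p + r = p + (a * p + r)" by simp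
  show ?case
  proof (cases b)
    case 0
    have "[Suc a * p + r choose s = (a * p + r choose s)] (mod p)"
      unfolding eq using choose_add_prime_cong[OF p, of "a * p + r" s] s by simp
    then show ?thesis using Suc.IH[of 0] 0 by (auto intro: cong_trans)
  next
    case (Suc c)
    have "[Suc a * p + r choose (b * p + s) =
        (a * p + r choose (b * p + s)) + (a * p + r choose (c * p + s))] (mod p)"
      unfolding eq using choose_add_prime_cong[OF p, of "a * p + r" "b * p + s"] Suc by simp
    moreover have "[(a * p + r choose (b * p + s)) + (a * p + r choose (c * p + s)) =
        (a choose b) * (r choose s) + (a choose c) * (r choose s)] (mod p)"
      by (intro cong_add Suc.IH)
    ultimately show ?thesis using Suc by (auto simp: algebra_simps intro: cong_trans)
  qed
qed

text \<open>The last digit 0 of the lower index contributes \<open>r choose 0 = 1\<close>, so the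
  last digit of the added number has no influence.\<close>

lemma choose_mod_digit_0:
  fixes p :: nat
  assumes p: "Factorial_Ring.prime p" and r: "r < p"
  shows "((n * p + (d * p + r)) choose (n * p)) mod p = ((n + d) choose n) mod p"
  using Lucas_step[OF p r, of 0 "n + d" n] prime_gt_0_nat[OF p] by (simp add: cong_def algebra_simps)

lemma choose_mod_digit_max_0:
  fixes p :: nat
  assumes p: "Factorial_Ring.prime p"
  shows "((n * p + (p - 1) + d * p) choose (n * p + (p - 1))) mod p = ((n + d) choose n) mod p"
proof -
  have "p - 1 < p" using prime_gt_0_nat[OF p] by simp
  from Lucas_step[OF p this this, of "n + d" n] show ?thesis by (simp add: cong_def algebra_simps)
qed

text \<open>Adding the last digits \<open>p - 1\<close> and \<open>r > 0\<close> produces a carry: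
  the sum ends in the digit \<open>r - 1\<close>, and \<open>r - 1 choose (p - 1)\<close> is
  0.\<close>

lemma choose_mod_digit_max_pos:
  fixes p :: nat
  assumes p: "Factorial_Ring.prime p" and r: "0 < r" "r < p"
  shows "((n * p + (p - 1) + (d * p + r)) choose (n * p + (p - 1))) mod p = 0"
proof -
  have lt: "r - 1 < p" "p - 1 < p" using r by auto
  have eq: "n * p + (p - 1) + (d * p + r) = (n + d + 1) * p + (r - 1)"
    using r by (simp add: algebra_simps)
  show ?thesis
    unfolding eq using Lucas_step[OF p lt, of "n + d + 1" n] r by (simp add: cong_def binomial_eq_0)
qed

lemma digit_at_0: "digit p n 0 = n mod p" by (simp add: digit_def)

lemma digit_Suc: "digit p n (Suc k) = digit p (n div p) k"
  by (simp add: digit_def div_mult2_eq)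

lemma balanced_div: "balanced p n \<Longrightarrow> balanced p (n div p)"
  unfolding balanced_def using digit_Suc by metis

text \<open>Builds a balanced number from its leading digits: each step appends a last digit 0 or
  \<open>p - 1\<close>, matching the two cases of Lucas' theorem above.\<close>

lemma balanced_induct [consumes 2, case_names zero digit_0 digit_max]:
  assumes p: "p \<ge> 2" and n: "balanced p n"
    and zero: "P 0"
    and digit_0: "\<And>n. \<lbrakk>n > 0; balanced p n; P n\<rbrakk> \<Longrightarrow> P (n * p)"
    and digit_max: "\<And>n. \<lbrakk>balanced p n; P n\<rbrakk> \<Longrightarrow> P (n * p + (p - 1))"
  shows "P n"
  using n
proof (induction n rule: less_induct)
  case (less n)
  show ?case
  proof (cases "n = 0")
    case False
    then have "n div p < n" using p by simp
    then have IH: "P (n div p)" "balanced p (n div p)" using less balanced_div by auto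
    have "n mod p = 0 \<or> n mod p = p - 1"
      using less.prems digit_at_0[of p n] unfolding balanced_def by metis
    then show ?thesis
    proof
      assume "n mod p = 0"
      then have n: "n = n div p * p" by (metis add_0_right div_mult_mod_eq)
      then have "n div p > 0" using False by (metis gr0I mult_0)
      then show ?thesis using digit_0[of "n div p"] IH n by simp
    next
      assume "n mod p = p - 1"
      then have "n = n div p * p + (p - 1)" by (metis div_mult_mod_eq)
      then show ?thesis using digit_max[of "n div p"] IH by simp
    qed
  qed (use zero in simp)
qed

text \<open>By Lucas each digit contributes \<open>t choose 0\<close> or
  \<open>t choose (p - 1)\<close> with \<open>t < p\<close>, and both are 0 or 1.\<close>

lemma balanced_choose_mod_le_1:
  assumes p: "Factorial_Ring.prime p" and n: "balanced p n"
  shows "((n + d) choose n) mod p \<le> 1"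
proof -
  have p2: "p \<ge> 2" using p by (rule prime_ge_2_nat)
  show ?thesis
    using p2 n
  proof (induction n arbitrary: d rule: balanced_induct)
    case zero
    then show ?case by simp
  next
    case (digit_0 n)
    have "((n * p + (d div p * p + d mod p)) choose (n * p)) mod p = ((n + d div p) choose n) mod p"
      by (rule choose_mod_digit_0[OF p]) (use p2 in simp)
    then show ?case using digit_0.IH[of "d div p"] by simp
  next
    case (digit_max n)
    show ?case
    proof (cases "d mod p = 0")
      case True
      then have "d = d div p * p" by (metis add_0_right div_mult_mod_eq)
      then show ?thesis
        using choose_mod_digit_max_0[OF p, of n "d div p"] digit_max.IH[of "d div p"] by simp
    next
      case False
      then show ?thesis
        using choose_mod_digit_max_pos[OF p, of "d mod p" n "d div p"] p2 by simp
    qed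
  qed
qed

text \<open>The residues are lifted to complex numbers. Multiplied by \<open>1 - fps_X\<close>, that
  is after taking differences, this becomes the series of the values of
  \<open>monic_count_poly\<close> at a primitive root of unity.\<close>

definition binom_fps :: "nat \<Rightarrow> nat \<Rightarrow> complex fps" where
  "binom_fps p n = Abs_fps (\<lambda>d. of_nat (((n + d) choose n) mod p))"

text \<open>Coefficient of \<open>X H' / H\<close> for \<open>H\<close> the product of the
  \<open>(1 - X ^ (p ^ k)) ^ (- b_k)\<close>: each factor contributes \<open>b_k p ^ k\<close> at
  all positive multiples of \<open>p ^ k\<close>.\<close>

definition log_coeff :: "nat \<Rightarrow> nat \<Rightarrow> nat \<Rightarrow> complex" where
  "log_coeff p n m = (\<Sum>k | p ^ k dvd m. of_nat (p ^ k) * of_int (balanced_coeff p n k))"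

definition log_fps :: "nat \<Rightarrow> nat \<Rightarrow> complex fps" where
  "log_fps p n = Abs_fps (\<lambda>m. if m = 0 then 0 else log_coeff p n m)"

text \<open>The geometric series \<open>1 / (1 - X ^ j)\<close>.\<close>

definition multiples_fps :: "nat \<Rightarrow> complex fps" where
  "multiples_fps j = Abs_fps (\<lambda>m. of_bool (j dvd m))"

lemma fps_compose_X_power_nth:
  fixes f :: "'a :: comm_ring_1 fps"
  assumes "p > 0"
  shows "(f oo fps_X ^ p) $ m = (if p dvd m then f $ (m div p) else 0)"
proof -
  have "(f oo fps_X ^ p) $ m = (\<Sum>i=0..m. f $ i * (if m = p * i then 1 else 0))"
    by (simp add: fps_compose_nth power_mult[symmetric] fps_X_power_nth)
  also have "\<dots> = (\<Sum>i | i \<le> m \<and> m = p * i. f $ i)"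
    by (rule sum.mono_neutral_cong_right) auto
  also have "{i. i \<le> m \<and> m = p * i} = (if p dvd m then {m div p} else {})"
    using assms by (auto simp: div_le_dividend)
  finally show ?thesis by simp
qed

lemma multiples_fps:
  assumes "j > 0"
  shows "(1 - fps_X ^ j) * multiples_fps j = 1"
proof (rule fps_ext)
  fix m
  have "((1 - fps_X ^ j) * multiples_fps j) $ m =
      of_bool (j dvd m) - (if m < j then 0 else of_bool (j dvd (m - j)))"
    by (simp add: left_diff_distrib multiples_fps_def fps_X_power_mult_nth)
  also have "\<dots> = 1 $ m"
  proof (cases "m < j")
    case True
    then show ?thesis by (auto dest: dvd_imp_le)
  next
    case False
    then have "j dvd (m - j) \<longleftrightarrow> j dvd m" by (meson dvd_diffD dvd_diff_nat dvd_refl not_less)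
    then show ?thesis using assms False by auto
  qed
  finally show "((1 - fps_X ^ j) * multiples_fps j) $ m = 1 $ m" .
qed

text \<open>Appending a digit moves all coefficients up by one place; a digit \<open>p - 1\<close>,
  written as \<open>p ^ 1 - p ^ 0\<close>, adds one at place 1 and subtracts one at place 0.\<close>

lemma balanced_coeff_mult_add:
  assumes s: "s < p"
  shows "balanced_coeff p (n * p + s) 0 = - of_bool (s = p - 1)"
    and "balanced_coeff p (n * p + s) (Suc k) = balanced_coeff p n k + of_bool (k = 0 \<and> s = p - 1)"
proof -
  have [simp]: "(n * p + s) mod p = s" "(n * p + s) div p = n" using s by auto
  show "balanced_coeff p (n * p + s) 0 = - of_bool (s = p - 1)"
    using s by (simp add: balanced_coeff_def digit_at_0)
  show "balanced_coeff p (n * p + s) (Suc k) = balanced_coeff p n k + of_bool (k = 0 \<and> s = p - 1)"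
    using s by (cases k) (simp_all add: balanced_coeff_def digit_at_0 digit_Suc)
qed

lemma finite_power_dvd:
  assumes "p \<ge> (2::nat)" "m > 0"
  shows "finite {k. p ^ k dvd m}"
proof (rule finite_subset)
  show "{k. p ^ k dvd m} \<subseteq> {..m}"
  proof safe
    fix k assume "p ^ k dvd m"
    have "k < 2 ^ k" by (rule less_exp)
    also have "\<dots> \<le> p ^ k" using assms by (intro power_mono) auto
    also have "\<dots> \<le> m" using \<open>p ^ k dvd m\<close> assms by (intro dvd_imp_le)
    finally show "k \<le> m" by simp
  qed
qed simp

lemma log_coeff_mult_add:
  assumes p: "p \<ge> 2" and s: "s < p" and m: "m > 0"
  shows "log_coeff p (n * p + s) m =
    (if p dvd m then of_nat p * log_coeff p n (m div p) else 0)
     + of_bool (s = p - 1) * (of_nat p * of_bool (p dvd m) - 1)"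
proof -
  note fin = finite_power_dvd[OF p m]
  have split: "{k. p ^ k dvd m} = insert 0 (Suc ` {k. p ^ Suc k dvd m})"
    by (auto simp: image_iff) (metis not0_implies_Suc power_0 power_Suc)+
  have fin': "finite {k. p ^ Suc k dvd m}"
    using fin unfolding split by (simp add: finite_image_iff)
  have "log_coeff p (n * p + s) m = of_int (balanced_coeff p (n * p + s) 0) +
      (\<Sum>k | p ^ Suc k dvd m. of_nat (p ^ Suc k) * of_int (balanced_coeff p (n * p + s) (Suc k)))"
    unfolding log_coeff_def split using fin' by (subst sum.insert) (auto simp: sum.reindex)
  also have "\<dots> = - of_bool (s = p - 1) +
      (\<Sum>k | p ^ Suc k dvd m. of_nat (p ^ Suc k) * of_int (balanced_coeff p n k) +
         (if k = 0 then of_nat p * of_bool (s = p - 1) else 0))"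
    unfolding balanced_coeff_mult_add[OF s] by (auto intro!: sum.cong simp: algebra_simps)
  also have "\<dots> = - of_bool (s = p - 1) +
      (\<Sum>k | p ^ Suc k dvd m. of_nat (p ^ Suc k) * of_int (balanced_coeff p n k)) +
      of_nat p * of_bool (p dvd m) * of_bool (s = p - 1)"
    using fin' by (simp add: sum.distrib)
  also have "(\<Sum>k | p ^ Suc k dvd m. of_nat (p ^ Suc k) * of_int (balanced_coeff p n k)) =
      (if p dvd m then of_nat p * log_coeff p n (m div p) else (0 :: complex))"
  proof (cases "p dvd m")
    case True
    then have "p ^ Suc k dvd m \<longleftrightarrow> p ^ k dvd m div p" for k
      using p by (auto elim!: dvdE)
    then show ?thesis using True
      by (simp add: log_coeff_def sum_distrib_left mult.assoc)
  next
    case False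
    then have "{k. p ^ Suc k dvd m} = {}" by (auto dest: dvd_mult_left)
    then show ?thesis using False by simp
  qed
  finally show ?thesis by (simp add: algebra_simps)
qed

text \<open>Appending a digit substitutes \<open>X ^ p\<close> for \<open>X\<close> in the product,
  which multiplies the logarithmic derivative by \<open>p\<close>; a digit \<open>p - 1\<close>
  brings the additional factor \<open>(1 - X) / (1 - X ^ p)\<close>.\<close>

lemma log_fps_mult_add:
  assumes p: "p \<ge> 2" and s: "s < p"
  shows "log_fps p (n * p + s) = of_nat p * (log_fps p n oo fps_X ^ p) +
    of_bool (s = p - 1) * (of_nat p * fps_X ^ p * multiples_fps p - fps_X * multiples_fps 1)"
proof (rule fps_ext)
  fix m
  have 1: "(fps_X ^ p * multiples_fps p) $ m = of_bool (m > 0 \<and> p dvd m)"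
  proof (cases "m < p")
    case True
    then show ?thesis using p by (auto simp: fps_X_power_mult_nth dest: dvd_imp_le)
  next
    case False
    then have "p dvd (m - p) \<longleftrightarrow> p dvd m" by (meson dvd_diffD dvd_diff_nat dvd_refl not_less)
    then show ?thesis using p False by (auto simp: fps_X_power_mult_nth multiples_fps_def)
  qed
  have 2: "(fps_X * multiples_fps 1) $ m = of_bool (m > 0)"
    by (simp add: multiples_fps_def)
  have 3: "(of_nat p * f) $ m = of_nat p * f $ m" for f :: "complex fps"
    by (simp add: fps_of_nat[symmetric])
  have 4: "(of_bool b * f) $ m = of_bool b * f $ m" for b and f :: "complex fps" by simp
  have 5: "(log_fps p n oo fps_X ^ p) $ m = (if m > 0 \<and> p dvd m then log_coeff p n (m div p) else 0)"
    using p by (auto simp: fps_compose_X_power_nth log_fps_def elim!: dvdE)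
  show "log_fps p (n * p + s) $ m = (of_nat p * (log_fps p n oo fps_X ^ p) +
      of_bool (s = p - 1) * (of_nat p * fps_X ^ p * multiples_fps p - fps_X * multiples_fps 1)) $ m"
    unfolding mult.assoc fps_add_nth fps_sub_nth 3 4 1 2 5
    using log_coeff_mult_add[OF p s, of m n] by (cases "m > 0") (simp_all add: log_fps_def)
qed

text \<open>The coefficients of \<open>binom_fps p (n * p)\<close> are constant on blocks of length
  \<open>p\<close>, so their differences survive only at multiples of \<open>p\<close>.\<close>

lemma binom_fps_digit_0:
  assumes p: "Factorial_Ring.prime p"
  shows "(1 - fps_X) * binom_fps p (n * p) = ((1 - fps_X) * binom_fps p n) oo fps_X ^ p"
proof -
  have p0: "p > 0" using p by (rule prime_gt_0_nat)
  have nth: "binom_fps p (n * p) $ d = binom_fps p n $ (d div p)" for d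
    using choose_mod_digit_0[OF p, of "d mod p" n "d div p"] p0 by (simp add: binom_fps_def)
  show ?thesis
  proof (rule fps_ext)
    fix d
    have "((1 - fps_X) * binom_fps p (n * p)) $ d =
        binom_fps p n $ (d div p) - (if d = 0 then 0 else binom_fps p n $ ((d - 1) div p))"
      by (simp add: left_diff_distrib nth)
    also have "\<dots> = (if p dvd d then
        binom_fps p n $ (d div p) - (if d div p = 0 then 0 else binom_fps p n $ (d div p - 1)) else 0)"
    proof (cases "p dvd d")
      case True
      then obtain c where c: "d = p * c" by blast
      show ?thesis
      proof (cases c)
        case (Suc e)
        have "(d - 1) div p = e" by (rule div_nat_eqI) (use p0 in \<open>auto simp: c Suc\<close>)
        then show ?thesis using p0 by (simp add: c Suc)
      qed (simp add: c)
    next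
      case False
      then have "d mod p > 0" by (simp add: mod_greater_zero_iff_not_dvd)
      then have "d - 1 = d div p * p + (d mod p - 1)"
        by (metis Nat.add_diff_assoc Suc_leI One_nat_def div_mult_mod_eq)
      then have "(d - 1) div p = d div p + (d mod p - 1) div p" using p0 by simp
      moreover have "(d mod p - 1) div p = 0"
        using p0 mod_less_divisor[of p d] by (intro div_less) linarith
      ultimately have "(d - 1) div p = d div p" by simp
      moreover have "d \<noteq> 0" using False by (metis dvd_0_right)
      ultimately show ?thesis using False by simp
    qed
    also have "\<dots> = (((1 - fps_X) * binom_fps p n) oo fps_X ^ p) $ d"
      using p0 by (simp add: fps_compose_X_power_nth left_diff_distrib)
    finally show "((1 - fps_X) * binom_fps p (n * p)) $ d =
      (((1 - fps_X) * binom_fps p n) oo fps_X ^ p) $ d" .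
  qed
qed

text \<open>Off the multiples of \<open>p\<close> the coefficients vanish because of the carry.
  Unlike for the digit 0, the relation holds without the factor \<open>1 - X\<close>; restoring it
  produces \<open>(1 - X) / (1 - X ^ p)\<close>.\<close>

lemma binom_fps_digit_max:
  assumes p: "Factorial_Ring.prime p"
  shows "binom_fps p (n * p + (p - 1)) = binom_fps p n oo fps_X ^ p"
proof (rule fps_ext)
  fix d
  have p0: "p > 0" using p by (rule prime_gt_0_nat)
  show "binom_fps p (n * p + (p - 1)) $ d = (binom_fps p n oo fps_X ^ p) $ d"
  proof (cases "p dvd d")
    case True
    then show ?thesis using p0 choose_mod_digit_max_0[OF p, of n "d div p"]
      by (simp add: fps_compose_X_power_nth binom_fps_def)
  next
    case False
    then have "d mod p > 0" by (simp add: mod_greater_zero_iff_not_dvd)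
    then show ?thesis using p0 False choose_mod_digit_max_pos[OF p, of "d mod p" n "d div p"]
      by (simp add: fps_compose_X_power_nth binom_fps_def)
  qed
qed

lemma log_derivative_compose:
  fixes h s :: "complex fps"
  assumes "p > 0" "fps_X * fps_deriv h = s * h"
  shows "fps_X * fps_deriv (h oo fps_X ^ p) = of_nat p * (s oo fps_X ^ p) * (h oo fps_X ^ p)"
proof -
  have z: "(fps_X ^ p :: complex fps) $ 0 = 0" using assms(1) by simp
  have "fps_X * fps_deriv (h oo fps_X ^ p) =
      (fps_deriv h oo fps_X ^ p) * (of_nat p * (fps_X * fps_X ^ (p - 1)))"
    by (simp add: fps_compose_deriv[OF z] fps_deriv_power')
  also have "fps_X * fps_X ^ (p - 1) = (fps_X ^ p :: complex fps)"
    using assms(1) by (simp flip: power_Suc)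
  also have "(fps_deriv h oo fps_X ^ p) * (of_nat p * fps_X ^ p) =
      of_nat p * ((fps_X * fps_deriv h) oo fps_X ^ p)"
    by (simp add: fps_compose_mult_distrib[OF z] fps_X_fps_compose_startby0[OF z])
  also have "\<dots> = of_nat p * (s oo fps_X ^ p) * (h oo fps_X ^ p)"
    by (simp add: assms(2) fps_compose_mult_distrib[OF z])
  finally show ?thesis .
qed

text \<open>The power series \<open>(1 - X) binom_fps p n\<close> is the product of the \<open>(1 - X\<^bsup>p^k\<^esup>)\<^bsup>-b\<^sub>k\<^esup>\<close>;
  this is stated through its logarithmic derivative.\<close>

lemma binom_fps_log_derivative:
  assumes p: "Factorial_Ring.prime p" and n: "balanced p n"
  shows "fps_X * fps_deriv ((1 - fps_X) * binom_fps p n) = log_fps p n * ((1 - fps_X) * binom_fps p n)"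
proof -
  have p2: "p \<ge> 2" using p by (rule prime_ge_2_nat)
  then have z: "(fps_X ^ p :: complex fps) $ 0 = 0" by simp
  show ?thesis
    using p2 n
  proof (induction n rule: balanced_induct)
    case zero
    have "binom_fps p 0 = multiples_fps 1" using p2 by (auto simp: binom_fps_def multiples_fps_def)
    then have "(1 - fps_X) * binom_fps p 0 = 1" using multiples_fps[of 1] by simp
    moreover have "balanced_coeff p 0 k = 0" for k
      using p2 by (simp add: balanced_coeff_def digit_def)
    then have "log_fps p 0 = 0" by (simp add: log_fps_def log_coeff_def fps_eq_iff)
    ultimately show ?case by simp
  next
    case (digit_0 n)
    have "log_fps p (n * p) = of_nat p * (log_fps p n oo fps_X ^ p)"
      using log_fps_mult_add[OF p2, of 0 n] p2 by simp
    then show ?case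
      using log_derivative_compose[OF _ digit_0.IH, of p] p2
      by (simp add: binom_fps_digit_0[OF p])
  next
    case (digit_max n)
    define K where "K = ((1 - fps_X) * binom_fps p n) oo fps_X ^ p"
    define T where "T = log_fps p n oo fps_X ^ p"
    define H where "H = (1 - fps_X) * binom_fps p (n * p + (p - 1))"
    define S where "S = log_fps p (n * p + (p - 1))"
    define X :: "complex fps" where "X = fps_X"
    define Y where "Y = X ^ p"
    define E\<^sub>p where "E\<^sub>p = multiples_fps p"
    define E where "E = multiples_fps 1"
    have S: "S = of_nat p * T + of_nat p * Y * E\<^sub>p - X * E"
      using log_fps_mult_add[OF p2, of "p - 1" n] p2
      by (simp add: S_def T_def Y_def X_def E\<^sub>p_def E_def)
    have EY: "(1 - Y) * E\<^sub>p = 1" using multiples_fps[of p] p2 by (simp add: Y_def X_def E\<^sub>p_def)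
    have EX: "(1 - X) * E = 1" using multiples_fps[of 1] by (simp add: X_def E_def)
    have K: "X * fps_deriv K = of_nat p * T * K"
      using log_derivative_compose[OF _ digit_max.IH, of p] p2 by (simp add: K_def T_def X_def)
    have "K = (1 - Y) * (binom_fps p n oo fps_X ^ p)"
      unfolding K_def fps_compose_mult_distrib[OF z]
      by (simp add: fps_compose_sub_distrib fps_X_fps_compose_startby0[OF z] X_def Y_def)
    \<comment> \<open>The relation between the old and the new series is kept free of denominators
      and differentiated in this form; \<open>1 - Y\<close> is cancelled only at the end.\<close>
    then have HK: "(1 - Y) * H = (1 - X) * K"
      unfolding H_def binom_fps_digit_max[OF p] X_def by (simp add: mult_ac)
    have dY: "X * fps_deriv Y = of_nat p * Y"
      using p2 by (simp add: X_def Y_def fps_deriv_power' mult.left_commute flip: power_Suc)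
    have dX: "fps_deriv X = 1" by (simp add: X_def)
    have "X * fps_deriv ((1 - Y) * H) = X * fps_deriv ((1 - X) * K)" by (simp only: HK)
    then have "(1 - Y) * (X * fps_deriv H) - (X * fps_deriv Y) * H = (1 - X) * (X * fps_deriv K) - X * K"
      by (simp add: dX algebra_simps)
    then have 1: "(1 - Y) * (X * fps_deriv H) = of_nat p * Y * H + of_nat p * T * ((1 - Y) * H) - X * K"
      unfolding dY K HK by (simp add: algebra_simps)
    have "(1 - Y) * (S * H) = of_nat p * T * ((1 - Y) * H) + of_nat p * Y * (((1 - Y) * E\<^sub>p) * H) - X * E * ((1 - Y) * H)"
      unfolding S by (simp add: algebra_simps)
    also have "X * E * ((1 - Y) * H) = X * (((1 - X) * E) * K)" unfolding HK by (simp add: mult_ac)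
    finally have "(1 - Y) * (S * H) = (1 - Y) * (X * fps_deriv H)" unfolding 1 EY EX by simp
    moreover have "1 - Y \<noteq> 0" using EY by auto
    ultimately have "X * fps_deriv H = S * H" by simp
    then show ?case by (simp add: X_def S_def H_def)
  qed
qed


text \<open>Evaluation in any field of characteristic 0, so that the same identities serve at prime
  powers in \<open>rat\<close> and at roots of unity in \<open>complex\<close>.\<close>

definition rat_eval :: "'a :: field_char_0 \<Rightarrow> rat poly \<Rightarrow> 'a" where
  "rat_eval x P = poly (map_poly of_rat P) x"

lemma coeff_map_poly_of_rat: "Polynomial.coeff (map_poly of_rat P) i = of_rat (Polynomial.coeff P i)"
  by (simp add: coeff_map_poly)

lemma rat_eval_rat: "rat_eval (x :: rat) P = poly P x"
  by (simp add: rat_eval_def map_poly_id)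

lemma rat_eval_0: "rat_eval x 0 = 0"
  by (simp add: rat_eval_def)

lemma rat_eval_add: "rat_eval x (P + Q) = rat_eval x P + rat_eval x Q"
proof -
  have "map_poly of_rat (P + Q) = (map_poly of_rat P + map_poly of_rat Q :: 'a poly)"
    by (rule poly_eqI) (simp add: coeff_map_poly_of_rat of_rat_add)
  then show ?thesis by (simp add: rat_eval_def)
qed

lemma rat_eval_mult: "rat_eval x (P * Q) = rat_eval x P * rat_eval x Q"
proof -
  have "map_poly of_rat (P * Q) = (map_poly of_rat P * map_poly of_rat Q :: 'a poly)"
    by (rule poly_eqI) (simp add: coeff_map_poly_of_rat coeff_mult of_rat_sum of_rat_mult)
  then show ?thesis by (simp add: rat_eval_def)
qed

lemma rat_eval_monom: "rat_eval x (Polynomial.monom c i) = of_rat c * x ^ i"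
  by (simp add: rat_eval_def map_poly_monom poly_monom)

lemma rat_eval_of_nat: "rat_eval x (of_nat c) = of_nat c"
  using rat_eval_monom[of x "of_nat c" 0] by (simp add: monom_0 of_nat_poly)

lemma rat_eval_sum: "rat_eval x (\<Sum>i\<in>I. f i) = (\<Sum>i\<in>I. rat_eval x (f i))"
  by (induction I rule: infinite_finite_induct) (simp_all add: rat_eval_0 rat_eval_add)

text \<open>In the instance for \<open>d\<close> the value \<open>f d\<close> occurs only in the
  term \<open>k = j = d\<close>, with the nonzero factor \<open>d * h 0\<close>; all other values
  have smaller index.\<close>

lemma divisor_recursion_unique:
  fixes f g h :: "nat \<Rightarrow> 'a :: field_char_0"
  assumes h: "h 0 \<noteq> 0"
    and f: "\<And>d. d \<ge> 1 \<Longrightarrow>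
      of_nat d * h d = (\<Sum>k=1..d. (\<Sum>j | j dvd k. of_nat j * f j) * h (d - k))"
    and g: "\<And>d. d \<ge> 1 \<Longrightarrow>
      of_nat d * h d = (\<Sum>k=1..d. (\<Sum>j | j dvd k. of_nat j * g j) * h (d - k))"
    and "d \<ge> 1"
  shows "f d = g d"
  using \<open>d \<ge> 1\<close>
proof (induction d rule: less_induct)
  case (less d)
  have split: "{1..d} = insert d {1..<d}" using less.prems by auto
  have split': "{j. j dvd d} = insert d {j. j dvd d \<and> j < d}"
    using less.prems by (auto dest: dvd_imp_le)
  have fin: "finite {j. j dvd d \<and> j < d}" by simp
  have div_eq: "of_nat j * f j = of_nat j * g j" if "j < d" for j
    using less.IH[of j] that by (cases "j = 0") auto
  have "(\<Sum>k=1..<d. (\<Sum>j | j dvd k. of_nat j * f j) * h (d - k)) =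
      (\<Sum>k=1..<d. (\<Sum>j | j dvd k. of_nat j * g j) * h (d - k))"
  proof (rule sum.cong[OF refl])
    fix k assume k: "k \<in> {1..<d}"
    have "(\<Sum>j | j dvd k. of_nat j * f j) = (\<Sum>j | j dvd k. of_nat j * g j)"
    proof (rule sum.cong[OF refl])
      fix j assume "j \<in> {j. j dvd k}"
      then have "j \<le> k" using k by (auto intro: dvd_imp_le)
      then show "of_nat j * f j = of_nat j * g j" using k by (intro div_eq) simp
    qed
    then show "(\<Sum>j | j dvd k. of_nat j * f j) * h (d - k) = (\<Sum>j | j dvd k. of_nat j * g j) * h (d - k)"
      by simp
  qed
  then have "(\<Sum>j | j dvd d. of_nat j * f j) * h 0 = (\<Sum>j | j dvd d. of_nat j * g j) * h 0"
    using f[OF less.prems] g[OF less.prems] unfolding split by auto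
  then have "(\<Sum>j | j dvd d. of_nat j * f j) = (\<Sum>j | j dvd d. of_nat j * g j)" using h by simp
  moreover have "(\<Sum>j | j dvd d \<and> j < d. of_nat j * f j) = (\<Sum>j | j dvd d \<and> j < d. of_nat j * g j)"
    by (intro sum.cong refl div_eq) auto
  ultimately show ?case unfolding split' using fin less.prems by simp
qed

text \<open>The geometric sum is the quotient of
  \<open>x ^ (n + d choose n) - x ^ (n + d - 1 choose n)\<close> by \<open>x - 1\<close>, which
  makes it visibly a polynomial. For \<open>n \<ge> 1\<close> and \<open>d = 0\<close> the lower
  limit is \<open>n - 1 choose n = 0\<close>, so the value is 1.\<close>

definition monic_count_poly :: "nat \<Rightarrow> nat \<Rightarrow> rat poly" where
  "monic_count_poly n d = (\<Sum>i = (n + d - 1 choose n)..<(n + d choose n). Polynomial.monom 1 i)"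

lemma monic_count_poly_0: "n \<ge> 1 \<Longrightarrow> monic_count_poly n 0 = 1"
  by (simp add: monic_count_poly_def binomial_eq_0)

lemma geometric_sum_interval:
  fixes x :: "'a :: comm_ring_1"
  assumes "a \<le> b"
  shows "(x - 1) * (\<Sum>i=a..<b. x ^ i) = x ^ b - x ^ a"
  using assms by (induction b rule: dec_induct) (simp_all add: algebra_simps)

lemma rat_eval_monic_count_poly:
  "(x - 1) * rat_eval x (monic_count_poly n d) = x ^ (n + d choose n) - x ^ (n + d - 1 choose n)"
proof -
  have "(n + d - 1 choose n) \<le> (n + d choose n)" by (cases n; cases "n + d") auto
  then show ?thesis
    by (simp add: monic_count_poly_def rat_eval_sum rat_eval_monom geometric_sum_interval)
qed

text \<open>The recursion solved for its term \<open>k = j = d\<close>, using that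
  \<open>monic_count_poly n 0\<close> is 1; division by \<open>d\<close> is why the coefficients are
  rational.\<close>

function irreducible_count_poly :: "nat \<Rightarrow> nat \<Rightarrow> rat poly" where
  "irreducible_count_poly n d = Polynomial.smult (1 / of_nat d)
     (of_nat d * monic_count_poly n d
      - (\<Sum>k=1..<d. (\<Sum>j | j dvd k. of_nat j * irreducible_count_poly n j) * monic_count_poly n (d - k))
      - (\<Sum>j | j dvd d \<and> j < d. of_nat j * irreducible_count_poly n j))"
  by auto
termination
  by (relation "measure snd") (auto dest: dvd_imp_le)

declare irreducible_count_poly.simps [simp del]

lemma irreducible_count_poly_recursion:
  assumes "n \<ge> 1" "d \<ge> 1"
  shows "of_nat d * monic_count_poly n d =
    (\<Sum>k=1..d. (\<Sum>j | j dvd k. of_nat j * irreducible_count_poly n j) * monic_count_poly n (d - k))"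
proof -
  have split: "{1..d} = insert d {1..<d}" using assms by auto
  have split': "{j. j dvd d} = insert d {j. j dvd d \<and> j < d}"
    using assms by (auto dest: dvd_imp_le)
  have fin: "finite {j. j dvd d \<and> j < d}" by simp
  have "of_nat d * irreducible_count_poly n d = of_nat d * monic_count_poly n d
      - (\<Sum>k=1..<d. (\<Sum>j | j dvd k. of_nat j * irreducible_count_poly n j) * monic_count_poly n (d - k))
      - (\<Sum>j | j dvd d \<and> j < d. of_nat j * irreducible_count_poly n j)"
    by (subst irreducible_count_poly.simps) (use assms in \<open>simp add: of_nat_poly\<close>)
  then show ?thesis
    unfolding split using assms
    by (simp add: monic_count_poly_0, unfold split') (simp add: fin algebra_simps)
qed

text \<open>The hinge of the proof: with \<open>x\<close> a field order it identifies the numbers of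
  irreducibles, with \<open>x\<close> a root of unity the balanced coefficients.\<close>

lemma rat_eval_irreducible_count_poly_unique:
  fixes g :: "nat \<Rightarrow> 'a :: field_char_0"
  assumes n: "n \<ge> 1"
    and g: "\<And>d. d \<ge> 1 \<Longrightarrow> of_nat d * rat_eval x (monic_count_poly n d) =
      (\<Sum>k=1..d. (\<Sum>j | j dvd k. of_nat j * g j) * rat_eval x (monic_count_poly n (d - k)))"
    and d: "d \<ge> 1"
  shows "rat_eval x (irreducible_count_poly n d) = g d"
proof (rule divisor_recursion_unique[OF _ _ g d])
  show "rat_eval x (monic_count_poly n 0) \<noteq> 0"
    using n rat_eval_of_nat[of x 1] by (simp add: monic_count_poly_0)
  fix d :: nat assume "d \<ge> 1"
  from arg_cong[OF irreducible_count_poly_recursion[OF n this], of "rat_eval x"]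
  show "of_nat d * rat_eval x (monic_count_poly n d) =
      (\<Sum>k=1..d. (\<Sum>j | j dvd k. of_nat j * rat_eval x (irreducible_count_poly n j)) *
         rat_eval x (monic_count_poly n (d - k)))"
    by (simp add: rat_eval_mult rat_eval_sum rat_eval_of_nat)
qed

lemma rat_eval_monic_count_poly_root_of_unity:
  assumes p: "Factorial_Ring.prime p" and n: "n \<ge> 1" "balanced p n"
    and z: "primitive_root_of_unity p z"
  shows "rat_eval z (monic_count_poly n d) = ((1 - fps_X) * binom_fps p n) $ d"
proof -
  have p2: "p \<ge> 2" using p by (rule prime_ge_2_nat)
  have z1: "z \<noteq> 1" "z ^ p = 1"
    using z p2 unfolding primitive_root_of_unity_def by (auto dest: spec[of _ 1])
  have pow: "z ^ (n + d choose n) = 1 + (z - 1) * binom_fps p n $ d" for d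
  proof -
    have "z ^ (n + d choose n) = z ^ (p * ((n + d choose n) div p) + (n + d choose n) mod p)" by simp
    also have "\<dots> = z ^ ((n + d choose n) mod p)"
      unfolding power_add power_mult z1(2) by simp
    \<comment> \<open>The residue is 0 or 1 since \<open>n\<close> is balanced, and on these two
      exponents the power is an affine function.\<close>
    also have "\<dots> = 1 + (z - 1) * of_nat ((n + d choose n) mod p)"
      using balanced_choose_mod_le_1[OF p n(2), of d] by (auto simp: le_Suc_eq)
    finally show ?thesis by (simp add: binom_fps_def)
  qed
  have "(z - 1) * rat_eval z (monic_count_poly n d) = z ^ (n + d choose n) - z ^ (n + d - 1 choose n)"
    by (rule rat_eval_monic_count_poly)
  also have "\<dots> = (z - 1) * ((1 - fps_X) * binom_fps p n) $ d"
  proof (cases d)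
    \<comment> \<open>Here \<open>n + d - 1 choose n\<close> is 0 instead of a preceding binomial
      coefficient, in accordance with the constant term 1 of the series.\<close>
    case 0
    then show ?thesis using n p2 by (simp add: left_diff_distrib binomial_eq_0 binom_fps_def)
  next
    case (Suc e)
    then show ?thesis using pow[of d] pow[of e] by (simp add: left_diff_distrib right_diff_distrib)
  qed
  finally show ?thesis using z1 by simp
qed

text \<open>The sum over \<open>k\<close> has at most one term, as \<open>p \<ge> 2\<close>; it
  expresses the case distinction on \<open>d\<close> in a form that can be summed over
  divisors.\<close>

theorem rat_eval_irreducible_count_poly_root_of_unity:
  assumes p: "Factorial_Ring.prime p" and n: "n \<ge> 1" "balanced p n"
    and z: "primitive_root_of_unity p z" and d: "d \<ge> 1"
  shows "rat_eval z (irreducible_count_poly n d) = (\<Sum>k | p ^ k = d. of_int (balanced_coeff p n k))"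
proof (rule rat_eval_irreducible_count_poly_unique[OF n(1) _ d])
  fix d :: nat assume d: "d \<ge> 1"
  have p2: "p \<ge> 2" using p by (rule prime_ge_2_nat)
  define g :: "nat \<Rightarrow> complex" where "g j = (\<Sum>k | p ^ k = j. of_int (balanced_coeff p n k))" for j
  define H where "H = (1 - fps_X) * binom_fps p n"
  have g_sum: "(\<Sum>j | j dvd m. of_nat j * g j) = log_coeff p n m" if m: "m > 0" for m
  proof -
    have "(\<Sum>j | j dvd m. of_nat j * g j) =
        (\<Sum>j | j dvd m. \<Sum>k | k \<in> {k. p ^ k dvd m} \<and> p ^ k = j. of_nat (p ^ k) * of_int (balanced_coeff p n k))"
    proof (rule sum.cong[OF refl])
      fix j assume "j \<in> {j. j dvd m}"
      then have "{k. p ^ k = j} = {k. k \<in> {k. p ^ k dvd m} \<and> p ^ k = j}" by auto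
      then show "of_nat j * g j =
          (\<Sum>k | k \<in> {k. p ^ k dvd m} \<and> p ^ k = j. of_nat (p ^ k) * of_int (balanced_coeff p n k))"
        unfolding g_def sum_distrib_left by (intro sum.cong) auto
    qed
    also have "\<dots> = log_coeff p n m"
      unfolding log_coeff_def using finite_power_dvd[OF p2 m] m by (intro sum.group) auto
    finally show ?thesis .
  qed
  \<comment> \<open>Comparing the coefficients of \<open>X ^ d\<close> in \<open>X H' = L H\<close>
    gives the recursion; the term \<open>k = 0\<close> drops out since \<open>L\<close> has constant
    term 0.\<close>
  have "of_nat d * H $ d = (fps_X * fps_deriv H) $ d"
    using d by (cases d) auto
  also have "\<dots> = (log_fps p n * H) $ d"
    using binom_fps_log_derivative[OF p n(2)] by (simp add: H_def)
  also have "\<dots> = (\<Sum>k=0..d. log_fps p n $ k * H $ (d - k))" by (simp add: fps_mult_nth)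
  also have "\<dots> = (\<Sum>k=1..d. (\<Sum>j | j dvd k. of_nat j * g j) * H $ (d - k))"
    by (rule sum.mono_neutral_cong_right) (auto simp: log_fps_def g_sum)
  finally show "of_nat d * rat_eval z (monic_count_poly n d) =
      (\<Sum>k=1..d. (\<Sum>j | j dvd k. of_nat j * (\<Sum>k | p ^ k = j. of_int (balanced_coeff p n k))) *
        rat_eval z (monic_count_poly n (d - k)))"
    unfolding rat_eval_monic_count_poly_root_of_unity[OF p n z] H_def g_def .
qed

section \<open>Polynomials over finite fields\<close>

text \<open>Pascal's rule: with \<open>n = k + 1\<close>, a monomial either avoids the last variable
  \<open>k\<close> or is that variable times a monomial of smaller size.\<close>

lemma monomials_card:
  "finite {m. set_mset m \<subseteq> {..<n} \<and> size m \<le> d} \<and>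
   card {m. set_mset m \<subseteq> {..<n :: nat} \<and> size m \<le> d} = (n + d) choose n"
proof (induction "n + d" arbitrary: n d rule: less_induct)
  case less
  show ?case
  proof (cases "n = 0 \<or> d = 0")
    case True
    then have "{m. set_mset m \<subseteq> {..<n} \<and> size m \<le> d} = {{#}}" by auto
    then show ?thesis using True by auto
  next
    case False
    then obtain k e where ke: "n = Suc k" "d = Suc e" by (meson not0_implies_Suc)
    have IH1: "finite {m. set_mset m \<subseteq> {..<k} \<and> size m \<le> d}"
      "card {m. set_mset m \<subseteq> {..<k} \<and> size m \<le> d} = (k + d) choose k"
      using less[of k d] ke by auto
    have IH2: "finite {m. set_mset m \<subseteq> {..<n} \<and> size m \<le> e}"
      "card {m. set_mset m \<subseteq> {..<n} \<and> size m \<le> e} = (n + e) choose n"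
      using less[of n e] ke by auto
    have eq: "{m. set_mset m \<subseteq> {..<n} \<and> size m \<le> d} =
        {m. set_mset m \<subseteq> {..<k} \<and> size m \<le> d} \<union> add_mset k ` {m. set_mset m \<subseteq> {..<n} \<and> size m \<le> e}"
      (is "?A = ?B \<union> ?C")
    proof (intro equalityI subsetI)
      fix m assume m: "m \<in> ?A"
      show "m \<in> ?B \<union> ?C"
      proof (cases "k \<in># m")
        case True
        then obtain m' where "m = add_mset k m'" by (metis multi_member_split)
        then show ?thesis using m ke by auto
      next
        case False
        then have "set_mset m \<subseteq> {..<k}" using m ke by (force simp: less_Suc_eq)
        then show ?thesis using m by auto
      qed
    qed (use ke in \<open>auto simp: less_Suc_eq\<close>)
    have "?B \<inter> ?C = {}" by auto
    moreover have "card ?C = (n + e) choose n"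
      using IH2(2) by (subst card_image) (auto simp: inj_on_def)
    ultimately have "card ?A = ((k + d) choose k) + ((n + e) choose n)"
      unfolding eq using IH1 IH2 by (subst card_Un_disjoint) auto
    also have "\<dots> = (n + d) choose n" using ke by simp
    finally show ?thesis using IH1(1) IH2(1) unfolding eq by simp
  qed
qed

text \<open>The strict bound covers degree 0 uniformly: for \<open>d = 0\<close> there are no
  monomials, and \<open>n - 1 choose n\<close> is 0 because \<open>n \<ge> 1\<close>.\<close>

lemma card_monomials_less:
  assumes "n \<ge> 1"
  shows "finite {m. set_mset m \<subseteq> {..<n} \<and> size m < d}"
    and "card {m. set_mset m \<subseteq> {..<n :: nat} \<and> size m < d} = (n + d - 1) choose n"
proof -
  have "finite {m. set_mset m \<subseteq> {..<n} \<and> size m < d} \<and>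
      card {m. set_mset m \<subseteq> {..<n :: nat} \<and> size m < d} = (n + d - 1) choose n"
  proof (cases d)
    case 0
    then show ?thesis using assms by (simp add: binomial_eq_0)
  next
    case (Suc e)
    then show ?thesis using monomials_card[of n e] by (simp add: less_Suc_eq_le)
  qed
  then show "finite {m. set_mset m \<subseteq> {..<n} \<and> size m < d}"
    and "card {m. set_mset m \<subseteq> {..<n :: nat} \<and> size m < d} = (n + d - 1) choose n" by auto
qed

lemma (in ring) card_mpoly_degree_less:
  assumes "n \<ge> 1" and fin: "finite (carrier R)"
  defines "B d \<equiv> {f \<in> carrier (mpoly_ring n R). \<forall>m. f m \<noteq> \<zero> \<longrightarrow> size m < d}"
  shows "finite (B d)" "card (B d) = card (carrier R) ^ ((n + d - 1) choose n)"
proof -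
  define S where "S = {m. set_mset m \<subseteq> {..<n} \<and> size m < d}"
  have S: "finite S" "card S = (n + d - 1) choose n"
    using card_monomials_less[OF assms(1)] by (auto simp: S_def)
  have "bij_betw (\<lambda>g m. if m \<in> S then g m else \<zero>) (PiE S (\<lambda>_. carrier R)) (B d)"
  proof (rule bij_betwI[where g = "\<lambda>f. restrict f S"])
    show "(\<lambda>g m. if m \<in> S then g m else \<zero>) \<in> (PiE S (\<lambda>_. carrier R)) \<rightarrow> B d"
    proof
      fix g assume g: "g \<in> PiE S (\<lambda>_. carrier R)"
      have "finite {m. (if m \<in> S then g m else \<zero>) \<noteq> \<zero>}"
        by (rule finite_subset[OF _ S(1)]) auto
      then show "(\<lambda>m. if m \<in> S then g m else \<zero>) \<in> B d"
        using g by (auto simp: B_def mpoly_ring_sel S_def)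
    qed
    show "(\<lambda>f. restrict f S) \<in> B d \<rightarrow> (PiE S (\<lambda>_. carrier R))"
      by (auto simp: B_def mpoly_ring_sel)
    fix f assume f: "f \<in> B d"
    have "f m = \<zero>" if "m \<notin> S" for m
      using that f by (auto simp: B_def mpoly_ring_sel S_def)
    then show "(\<lambda>m. if m \<in> S then restrict f S m else \<zero>) = f" by auto
  next
    fix g assume "g \<in> PiE S (\<lambda>_. carrier R)"
    then show "restrict (\<lambda>m. if m \<in> S then g m else \<zero>) S = g"
      by (auto simp: fun_eq_iff restrict_def PiE_def extensional_def)
  qed
  moreover have "finite (PiE S (\<lambda>_. carrier R))" using S fin by (intro finite_PiE)
  moreover have "card (PiE S (\<lambda>_. carrier R)) = card (carrier R) ^ card S"
    using S by (simp add: card_PiE)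
  ultimately show "finite (B d)" "card (B d) = card (carrier R) ^ ((n + d - 1) choose n)"
    using S by (auto simp: bij_betw_finite bij_betw_same_card)
qed

text \<open>Polynomials of degree exactly \<open>d\<close> are those of degree below
  \<open>d + 1\<close> minus those of degree below \<open>d\<close>; the zero polynomial lies in
  both sets and disappears.\<close>

lemma (in domain) card_mpoly_degree_eq:
  assumes n: "n \<ge> 1" and fin: "finite (carrier R)"
  defines "L d \<equiv> {f \<in> carrier (mpoly_ring n R). f \<noteq> \<zero>\<^bsub>mpoly_ring n R\<^esub> \<and> total_degree R f = d}"
  shows "finite (L d)"
    and "int (card (L d)) =
      int (card (carrier R)) ^ ((n + d) choose n) - int (card (carrier R)) ^ ((n + d - 1) choose n)"
proof -
  define B where "B d = {f \<in> carrier (mpoly_ring n R). \<forall>m. f m \<noteq> \<zero> \<longrightarrow> size m < d}" for d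
  note B = card_mpoly_degree_less[OF n fin, folded B_def]
  have L: "L d = B (Suc d) - B d"
  proof (intro equalityI subsetI)
    fix f assume "f \<in> L d"
    then have f: "f \<in> carrier (mpoly_ring n R)" "f \<noteq> \<zero>\<^bsub>mpoly_ring n R\<^esub>" "total_degree R f = d"
      by (auto simp: L_def)
    obtain m where m: "f m \<noteq> \<zero>" "size m = d" using total_degree_attained[OF f(1,2)] f(3) by auto
    then show "f \<in> B (Suc d) - B d"
      using f size_le_total_degree[OF f(1)] by (auto simp: B_def less_Suc_eq_le)
  next
    fix f assume "f \<in> B (Suc d) - B d"
    then obtain m where f: "f \<in> carrier (mpoly_ring n R)" "\<And>m. f m \<noteq> \<zero> \<Longrightarrow> size m \<le> d"
      and m: "f m \<noteq> \<zero>" "size m \<ge> d"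
      by (auto simp: B_def less_Suc_eq_le not_less)
    have nz: "f \<noteq> \<zero>\<^bsub>mpoly_ring n R\<^esub>" using m by (auto simp: mpoly_ring_sel)
    have "total_degree R f \<le> d" using total_degree_le_iff[OF f(1) nz] f(2) by blast
    moreover have "d \<le> total_degree R f" using size_le_total_degree[OF f(1) m(1)] m(2) by simp
    ultimately show "f \<in> L d" using f nz by (auto simp: L_def)
  qed
  have sub: "B d \<subseteq> B (Suc d)" by (auto simp: B_def)
  show "finite (L d)" unfolding L using B(1) by simp
  have "card (L d) = card (B (Suc d)) - card (B d)"
    unfolding L using B(1) sub by (intro card_Diff_subset)
  moreover have "card (B d) \<le> card (B (Suc d))" using B(1) sub by (intro card_mono)
  ultimately show "int (card (L d)) =
      int (card (carrier R)) ^ ((n + d) choose n) - int (card (carrier R)) ^ ((n + d - 1) choose n)"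
    by (simp add: B(2))
qed

text \<open>The units are the nonzero constants, so scaling orbits are classes of associates. The
  double count concerns all polynomials rather than monic ones, so both sides carry a factor
  \<open>q - 1\<close>, which is cancelled.\<close>

theorem card_monic_irreducibles:
  fixes F :: "('a, 'b) ring_scheme"
  assumes "field F" and fin: "finite (carrier F)" and n: "n \<ge> 1" and d: "d \<ge> 1"
  shows "poly (irreducible_count_poly n d) (of_nat (card (carrier F))) =
    of_nat (card (monic_irreducibles d n F))"
proof -
  interpret F: field F by (rule assms(1))
  interpret D: degree_ufd "mpoly_ring n F" "total_degree F" by (rule F.mpoly_degree_ufd)
  interpret D: finite_degree_ufd "mpoly_ring n F" "total_degree F"
    by unfold_locales (rule F.card_mpoly_degree_eq(1)[OF n fin])
  define q where "q = card (carrier F)"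
  have "card {\<zero>\<^bsub>F\<^esub>, \<one>\<^bsub>F\<^esub>} \<le> q" unfolding q_def using fin by (intro card_mono) auto
  then have q: "q \<ge> 2" by simp
  have units: "Units (mpoly_ring n F) = mpoly_const F ` (carrier F - {\<zero>\<^bsub>F\<^esub>})"
  proof (intro equalityI subsetI)
    fix u assume u: "u \<in> Units (mpoly_ring n F)"
    from total_degree_0_imp_const[OF D.Units_closed[OF u] D.Unit_nonzero[OF u] D.degree_Unit[OF u]]
    show "u \<in> mpoly_const F ` (carrier F - {\<zero>\<^bsub>F\<^esub>})" by blast
  qed (auto intro: F.mpoly_const_Unit)
  have orbit: "scaling_orbit F f = D.assoc_class f" if "f \<in> carrier (mpoly_ring n F)" for f
    unfolding scaling_orbit_def D.assoc_class_def units image_image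
    using that by (auto simp: F.mpoly_const_mult)
  have irr: "monic_irreducibles j n F = {C \<in> D.prime_classes. total_degree F (D.rep C) = j}" for j
    unfolding monic_irreducibles_def D.prime_classes_degree[symmetric]
    by (intro image_cong) (auto simp: orbit)
  have level: "rat_of_nat (card (D.level c)) = (of_nat q - 1) * rat_eval (of_nat q) (monic_count_poly n c)" for c
  proof -
    have "int (card (D.level c)) = int q ^ ((n + c) choose n) - int q ^ ((n + c - 1) choose n)"
      unfolding D.level_def q_def by (rule F.card_mpoly_degree_eq(2)[OF n fin])
    then have "rat_of_int (int (card (D.level c))) = of_int (int q ^ ((n + c) choose n) - int q ^ ((n + c - 1) choose n))"
      by simp
    then show ?thesis by (simp add: rat_eval_monic_count_poly)
  qed
  have "rat_eval (of_nat q) (irreducible_count_poly n d) = rat_of_nat (card (monic_irreducibles d n F))"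
  proof (rule rat_eval_irreducible_count_poly_unique[OF n _ d])
    fix d :: nat assume "d \<ge> 1"
    have "rat_of_nat (d * card (D.level d)) =
        of_nat (\<Sum>k=1..d. (\<Sum>j | j dvd k. j * card (monic_irreducibles j n F)) * card (D.level (d - k)))"
      unfolding irr by (rule arg_cong[OF D.degree_times_card_level])
    then have "(of_nat q - 1) * (of_nat d * rat_eval (of_nat q) (monic_count_poly n d)) =
        (of_nat q - 1) * (\<Sum>k=1..d. (\<Sum>j | j dvd k. of_nat j * of_nat (card (monic_irreducibles j n F))) *
          rat_eval (rat_of_nat q) (monic_count_poly n (d - k)))"
      by (simp add: level sum_distrib_left mult_ac)
    then show "of_nat d * rat_eval (of_nat q) (monic_count_poly n d) =
        (\<Sum>k=1..d. (\<Sum>j | j dvd k. of_nat j * of_nat (card (monic_irreducibles j n F))) *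
          rat_eval (rat_of_nat q) (monic_count_poly n (d - k)))"
      using q by simp
  qed
  then show ?thesis by (simp add: rat_eval_rat q_def)
qed

text \<open>\<open>M_poly\<close> ranges over fields whose carrier consists of natural numbers, so
  the residue field, built on integers, is moved along \<open>nat\<close>.\<close>

lemma field_of_prime_order:
  assumes "Factorial_Ring.prime q"
  obtains F :: "nat ring" where "field F" "card (carrier F) = q"
proof
  interpret residues_prime q "residue_ring (int q)" by unfold_locales (use assms in simp_all)
  have inj: "inj_on nat (carrier (residue_ring (int q)))"
    by (auto simp: inj_on_def residue_ring_def)
  show "field (image_ring nat (residue_ring (int q)))"
    by (rule inj_imp_image_ring_is_field[OF inj])
  show "card (carrier (image_ring nat (residue_ring (int q)))) = q"
    unfolding image_ring_carrier card_image[OF inj] by (simp add: residue_ring_def)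
qed

lemma poly_eqI_primes:
  fixes P Q :: "rat poly"
  assumes "\<And>q :: nat. Factorial_Ring.prime q \<Longrightarrow> poly P (of_nat q) = poly Q (of_nat q)"
  shows "P = Q"
proof (rule ccontr)
  assume "P \<noteq> Q"
  then have "finite {x. poly (P - Q) x = 0}" by (intro poly_roots_finite) simp
  moreover have "rat_of_nat ` {q. Factorial_Ring.prime q} \<subseteq> {x. poly (P - Q) x = 0}" using assms by auto
  ultimately have "finite (rat_of_nat ` {q. Factorial_Ring.prime q})" by (rule rev_finite_subset)
  then have "finite {q :: nat. Factorial_Ring.prime q}" by (rule finite_imageD) (auto simp: inj_on_def)
  then show False using primes_infinite by simp
qed

text \<open>The count gives the required values at all prime powers. Uniqueness is tested at primes:
  there are infinitely many, and residue rings supply the fields.\<close>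

lemma M_poly_eq:
  assumes n: "n \<ge> 1" and d: "d \<ge> 1"
  shows "M_poly d n = irreducible_count_poly n d"
  unfolding M_poly_def
proof (rule the_equality)
  show "\<forall>q::nat. primepow q \<longrightarrow> (\<forall>F :: nat ring. field F \<and> card (carrier F) = q \<longrightarrow>
      poly (irreducible_count_poly n d) (of_nat q) = of_nat (card (monic_irreducibles d n F)))"
  proof (intro allI impI, elim conjE)
    fix q :: nat and F :: "nat ring"
    assume q: "primepow q" and F: "field F" "card (carrier F) = q"
    have "finite (carrier F)" using F(2) primepow_gt_0_nat[OF q] by (intro card_ge_0_finite) simp
    then show "poly (irreducible_count_poly n d) (of_nat q) = of_nat (card (monic_irreducibles d n F))"
      using card_monic_irreducibles[OF F(1) _ n d] F(2) by simp
  qed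
next
  fix M :: "rat poly"
  assume M: "\<forall>q::nat. primepow q \<longrightarrow> (\<forall>F :: nat ring. field F \<and> card (carrier F) = q \<longrightarrow>
      poly M (of_nat q) = of_nat (card (monic_irreducibles d n F)))"
  show "M = irreducible_count_poly n d"
  proof (rule poly_eqI_primes)
    fix q :: nat assume q: "Factorial_Ring.prime q"
    obtain F :: "nat ring" where F: "field F" "card (carrier F) = q" using field_of_prime_order[OF q] .
    have "finite (carrier F)" using F(2) prime_gt_0_nat[OF q] by (intro card_ge_0_finite) simp
    then show "poly M (of_nat q) = poly (irreducible_count_poly n d) (of_nat q)"
      using card_monic_irreducibles[OF F(1) _ n d] F M primepow_prime[OF q] by simp
  qed
qed

section \<open>Cyclotomic polynomials of prime index\<close>

lemma primitive_root_of_unity_prime_iff: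
  assumes p: "Factorial_Ring.prime p"
  shows "primitive_root_of_unity p z \<longleftrightarrow> z ^ p = 1 \<and> z \<noteq> 1"
proof
  assume "primitive_root_of_unity p z"
  then show "z ^ p = 1 \<and> z \<noteq> 1"
    using prime_gt_1_nat[OF p] unfolding primitive_root_of_unity_def by (auto dest: spec[of _ 1])
next
  assume z: "z ^ p = 1 \<and> z \<noteq> 1"
  have "z ^ k \<noteq> 1" if k: "0 < k" "k < p" for k
  proof
    assume zk: "z ^ k = 1"
    have "coprime k p" using p k by (metis coprime_commute nat_dvd_not_less prime_imp_coprime)
    \<comment> \<open>Bezout gives \<open>k x = 1 + p y\<close>, so \<open>z ^ k = 1\<close> and
      \<open>z ^ p = 1\<close> together force \<open>z = 1\<close>.\<close>
    then obtain x y where "k * x = Suc (p * y)"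
      using bezout_nat[of k p] k by (auto simp: coprime_iff_gcd_eq_1)
    then have "z ^ (k * x) = z * z ^ (p * y)" by simp
    then show False using z zk by (simp add: power_mult)
  qed
  then show "primitive_root_of_unity p z"
    using z prime_gt_0_nat[OF p] by (simp add: primitive_root_of_unity_def)
qed

lemma primitive_roots_of_unity_prime:
  assumes p: "Factorial_Ring.prime p"
  shows "finite {z. primitive_root_of_unity p z}" "card {z. primitive_root_of_unity p z} = p - 1"
proof -
  have p0: "p > 0" using p by (rule prime_gt_0_nat)
  have eq: "{z. primitive_root_of_unity p z} = {z. z ^ p = 1} - {1}"
    by (auto simp: primitive_root_of_unity_prime_iff[OF p])
  show "finite {z. primitive_root_of_unity p z}" "card {z. primitive_root_of_unity p z} = p - 1"
    unfolding eq using p0 by (simp_all add: card_roots_unity_eq finite_roots_unity card_Diff_subset)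
qed

lemma cyclotomic_prime:
  assumes p: "Factorial_Ring.prime p"
  shows "cyclotomic p = (\<Sum>i<p. Polynomial.monom 1 i)"
proof -
  define S :: "rat poly" where "S = (\<Sum>i<p. Polynomial.monom 1 i)"
  let ?Z = "{z. primitive_root_of_unity p z}"
  note Z = primitive_roots_of_unity_prime[OF p]
  have p0: "p > 0" using p by (rule prime_gt_0_nat)
  have coeff_S: "Polynomial.coeff S i = (if i < p then 1 else 0)" for i
    by (simp add: S_def coeff_sum)
  have "map_poly of_rat S = (\<Prod>z\<in>?Z. [:- z, 1:])"
  proof (rule ccontr)
    assume ne: "map_poly of_rat S \<noteq> (\<Prod>z\<in>?Z. [:- z, 1:])"
    \<comment> \<open>Both polynomials are monic of degree \<open>p - 1\<close>, so \<open>D\<close>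
      has smaller degree, yet it vanishes at all \<open>p - 1\<close> primitive roots.\<close>
    define D where "D = map_poly of_rat S - (\<Prod>z\<in>?Z. [:- z, 1:])"
    have D_nz: "D \<noteq> 0" using ne by (simp add: D_def)
    have monic: "lead_coeff (\<Prod>z\<in>?Z. [:- z, 1:]) = 1" by (simp add: lead_coeff_prod)
    have deg: "degree (\<Prod>z\<in>?Z. [:- z, 1 :: complex:]) = p - 1"
      using Z by (subst degree_prod_eq_sum_degree) auto
    have "Polynomial.coeff D i = 0" if "i \<ge> p - 1" for i
    proof (cases "i = p - 1")
      case True
      then show ?thesis using monic deg p0 by (simp add: D_def coeff_map_poly_of_rat coeff_S)
    next
      case False
      then have "i > p - 1" "\<not> i < p" using that p0 by auto
      then show ?thesis using deg by (simp add: D_def coeff_map_poly_of_rat coeff_S coeff_eq_0)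
    qed
    then have "degree D < p - 1"
      using D_nz by (metis leading_coeff_0_iff not_le)
    moreover have "?Z \<subseteq> {z. poly D z = 0}"
    proof safe
      fix z assume z: "primitive_root_of_unity p z"
      have z1: "z ^ p = 1" "z \<noteq> 1" using z by (simp_all add: primitive_root_of_unity_prime_iff[OF p])
      have "poly (map_poly of_rat S) z = (\<Sum>i=0..<p. z ^ i)"
        unfolding rat_eval_def[symmetric] S_def
        by (simp add: rat_eval_sum rat_eval_monom lessThan_atLeast0)
      also have "\<dots> = 0" using geometric_sum_interval[of 0 p z] z1 by simp
      finally show "poly D z = 0" using Z(1) z by (auto simp: D_def poly_prod)
    qed
    then have "card ?Z \<le> card {z. poly D z = 0}" using D_nz by (intro card_mono poly_roots_finite)
    moreover have "card {z. poly D z = 0} \<le> degree D" using D_nz by (rule card_poly_roots_bound)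
    ultimately show False using Z(2) by linarith
  qed
  then show ?thesis
    unfolding cyclotomic_def S_def[symmetric]
  proof (rule the_equality)
    fix P assume "map_poly of_rat P = (\<Prod>z\<in>?Z. [:- z, 1:])"
    then have "map_poly of_rat P = (map_poly of_rat S :: complex poly)"
      using \<open>map_poly of_rat S = _\<close> by simp
    then have "of_rat (Polynomial.coeff P i) = (of_rat (Polynomial.coeff S i) :: complex)" for i
      by (metis coeff_map_poly_of_rat)
    then show "P = S" by (intro poly_eqI) simp
  qed
qed

text \<open>The remainder modulo \<open>cyclotomic p\<close> has degree below \<open>p - 1\<close>
  and vanishes at \<open>p - 1\<close> points. Assuming all primitive roots to be zeros of
  \<open>P\<close> avoids the irreducibility of the cyclotomic polynomial.\<close>

lemma cyclotomic_prime_dvd: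
  assumes p: "Factorial_Ring.prime p"
    and roots: "\<And>z. primitive_root_of_unity p z \<Longrightarrow> rat_eval z P = 0"
  shows "cyclotomic p dvd P"
proof -
  let ?Z = "{z. primitive_root_of_unity p z}"
  note Z = primitive_roots_of_unity_prime[OF p]
  have p0: "p > 0" using p by (rule prime_gt_0_nat)
  have coeff_S: "Polynomial.coeff (cyclotomic p) i = (if i < p then 1 else 0)" for i
    by (simp add: cyclotomic_prime[OF p] coeff_sum)
  have deg: "degree (cyclotomic p) = p - 1"
    using p0 by (intro antisym degree_le le_degree) (auto simp: coeff_S)
  have nz: "cyclotomic p \<noteq> 0" using coeff_S[of 0] p0 by auto
  define r where "r = P mod cyclotomic p"
  have P: "P = cyclotomic p * (P div cyclotomic p) + r" by (simp add: r_def)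
  have root_r: "rat_eval z r = 0" if z: "primitive_root_of_unity p z" for z
  proof -
    have z1: "z ^ p = 1" "z \<noteq> 1" using z by (simp_all add: primitive_root_of_unity_prime_iff[OF p])
    have "rat_eval z (cyclotomic p) = (\<Sum>i=0..<p. z ^ i)"
      unfolding cyclotomic_prime[OF p] by (simp add: rat_eval_sum rat_eval_monom lessThan_atLeast0)
    also have "\<dots> = 0" using geometric_sum_interval[of 0 p z] z1 by simp
    finally show ?thesis
      using roots[OF z] arg_cong[OF P, of "rat_eval z"] by (simp add: rat_eval_add rat_eval_mult)
  qed
  have "r = 0"
  proof (rule ccontr)
    assume r: "r \<noteq> 0"
    then have "degree r < p - 1" using degree_mod_less[OF nz, of P] deg by (auto simp: r_def)
    moreover have map_nz: "(map_poly of_rat r :: complex poly) \<noteq> 0"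
      using r by (subst map_poly_eq_0_iff) auto
    have "card ?Z \<le> card {z :: complex. poly (map_poly of_rat r) z = 0}"
      using root_r map_nz by (intro card_mono poly_roots_finite) (auto simp: rat_eval_def)
    moreover have "\<dots> \<le> degree (map_poly of_rat r :: complex poly)" using map_nz by (rule card_poly_roots_bound)
    moreover have "\<dots> \<le> degree r" by (intro degree_le) (simp add: coeff_map_poly_of_rat coeff_eq_0)
    ultimately show False using Z(2) by linarith
  qed
  then show ?thesis by (simp add: r_def mod_eq_0_iff_dvd)
qed

theorem theorem5p6:
  fixes p n :: nat
  assumes "Factorial_Ring.prime p" and "n \<ge> 1" and "balanced p n"
  shows "(\<forall>\<zeta>. primitive_root_of_unity p \<zeta> \<longrightarrow>
            (\<forall>d\<ge>1.
               (\<forall>k. d = p ^ k \<longrightarrow>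
                  poly (map_poly of_rat (M_poly d n)) \<zeta> = of_int (balanced_coeff p n k)) \<and>
               ((\<nexists>k. d = p ^ k) \<longrightarrow> poly (map_poly of_rat (M_poly d n)) \<zeta> = 0))) \<and>
         finite {d. d \<ge> 1 \<and> \<not> cyclotomic p dvd M_poly d n}"
proof (intro conjI allI impI)
  have p2: "p \<ge> 2" using assms(1) by (rule prime_ge_2_nat)
  have eval: "rat_eval \<zeta> (M_poly d n) = (\<Sum>k | p ^ k = d. of_int (balanced_coeff p n k))"
    if "primitive_root_of_unity p \<zeta>" "d \<ge> 1" for \<zeta> d
    unfolding M_poly_eq[OF assms(2) that(2)]
    by (rule rat_eval_irreducible_count_poly_root_of_unity[OF assms that])
  have powers: "{l. p ^ l = p ^ k} = {k}" for k using p2 by auto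
  fix \<zeta> and d :: nat assume *: "primitive_root_of_unity p \<zeta>" "1 \<le> d"
  show "poly (map_poly of_rat (M_poly d n)) \<zeta> = of_int (balanced_coeff p n k)" if "d = p ^ k" for k
    using eval[OF *] powers that by (simp add: rat_eval_def)
  show "poly (map_poly of_rat (M_poly d n)) \<zeta> = 0" if "\<nexists>k. d = p ^ k"
  proof -
    have "{l. p ^ l = d} = {}" using that by auto
    then show ?thesis using eval[OF *] by (simp add: rat_eval_def)
  qed
next
  have p2: "p \<ge> 2" using assms(1) by (rule prime_ge_2_nat)
  \<comment> \<open>Divisibility can fail only where some value at a primitive root is nonzero, that
    is at \<open>d = p ^ k\<close> with \<open>b_k\<close> nonzero; such \<open>k\<close> are at
    most \<open>n\<close>.\<close>
  have "{d. d \<ge> 1 \<and> \<not> cyclotomic p dvd M_poly d n} \<subseteq> (\<lambda>k. p ^ k) ` {..n}"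
  proof safe
    fix d assume d: "d \<ge> 1" "\<not> cyclotomic p dvd M_poly d n"
    then obtain \<zeta> where "primitive_root_of_unity p \<zeta>" "rat_eval \<zeta> (M_poly d n) \<noteq> 0"
      using cyclotomic_prime_dvd[OF assms(1)] by blast
    then have "(\<Sum>k | p ^ k = d. of_int (balanced_coeff p n k) :: complex) \<noteq> 0"
      using rat_eval_irreducible_count_poly_root_of_unity[OF assms _ d(1)] M_poly_eq[OF assms(2) d(1)] by simp
    then obtain k where k: "p ^ k = d" "balanced_coeff p n k \<noteq> 0"
      by (metis (mono_tags, lifting) mem_Collect_eq of_int_0 sum.neutral)
    then have "k \<le> n" using balanced_expansion(1)[OF p2 assms(3)] by auto
    then show "d \<in> (\<lambda>k. p ^ k) ` {..n}" using k by auto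
  qed
  then show "finite {d. d \<ge> 1 \<and> \<not> cyclotomic p dvd M_poly d n}" by (rule finite_subset) simp
qed

end
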